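(* Let $r_{4,5}(n)=\operatorname{CT}_{X_1,\ldots,X_5}\big(\sigma_4(Y_1,\ldots,Y_5)\big)^{n}$ with $Y_j=X_j+X_j^{-1}$, and let $R_{4,5}(z)=\sum_{n\ge0}r_{4,5}(n)z^n$. Then $R_{4,5}(z)$ satisfies a linear differential equation of order $9$ and degree $24$: there exist polynomials $u_0(z),\ldots,u_9(z)\in\mathbb{Q}[z]$ of degree at most $24$, with $u_9\ne 0$ and at least one $u_k$ of degree exactly $24$, such that $\sum_{k=0}^9 u_k(z)\vartheta^k R_{4,5}(z)=0$, where $\vartheta=z\frac{d}{dz}$. Accordingly, $r_{4,5}(n)$ satisfies a linear recurrence of order $24$ with polynomial coefficients.
   Context: $\sigma_4(y_1,\ldots,y_5)$ is the fourth elementary symmetric polynomial in five variables; $\operatorname{CT}$ denotes the constant term (coefficient of $X_1^0\cdots X_5^0$) of a Laurent polynomial. A linear recurrence of order $L$ with polynomial coefficients for $s(n)$ means polynomials $h_0,\ldots,h_L$, $h_0,h_L$ not identically zero, with $\sum_{j=0}^L h_j(n)s(n+j)=0$ for all $n\ge0$. *)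

theory Defs
  imports "HOL-Library.Poly_Mapping" "HOL-Computational_Algebra.Computational_Algebra"
begin

text \<open>Laurent polynomials with integer coefficients in variables X_0, X_1, ...:
  a monomial is a finitely supported exponent vector (nat =>0 int), and a Laurent
  polynomial is a finitely supported map from monomials to coefficients.\<close>

type_synonym laurent = "(nat \<Rightarrow>\<^sub>0 int) \<Rightarrow>\<^sub>0 int"

definition LX :: "nat \<Rightarrow> laurent" where
  "LX j = Poly_Mapping.single (Poly_Mapping.single j 1) 1"

definition LXinv :: "nat \<Rightarrow> laurent" where
  "LXinv j = Poly_Mapping.single (Poly_Mapping.single j (-1)) 1"

definition LY :: "nat \<Rightarrow> laurent" where
  "LY j = LX j + LXinv j"

definition CT :: "laurent \<Rightarrow> int" where
  "CT p = Poly_Mapping.lookup p 0"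

definition esym :: "nat \<Rightarrow> nat \<Rightarrow> (nat \<Rightarrow> 'a::comm_ring_1) \<Rightarrow> 'a" where
  "esym m k y = (\<Sum>S\<in>{S. S \<subseteq> {0..<m} \<and> card S = k}. \<Prod>i\<in>S. y i)"

definition r45 :: "nat \<Rightarrow> int" where
  "r45 n = CT ((esym 5 4 LY) ^ n)"

definition R45 :: "rat fps" where
  "R45 = Abs_fps (\<lambda>n. of_int (r45 n))"

definition theta :: "rat fps \<Rightarrow> rat fps" where
  "theta f = fps_X * fps_deriv f"

end

(*
  For Y = X + 1/X put Q_n(x) = sum_a CT(Y^(n-a)) x^a / a!.  Writing sigma_4 as (prod Y_j) (sum 1/Y_j) and
  expanding the n-th power of the sum gives r(n) = n! [x^n] Q_n(x)^5.  Since Q_(n+1)' = Q_n and Q satisfies a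
  linear recurrence, the degree-five monomials in Q_n, Q_(n+1), Q_(n+2) are carried into each other by x d/dx
  and by n -> n+1.  Modulo the functionals [x^m](x d/dx - m), which vanish identically, only a
  six-dimensional space over Q(m) of coefficient sequences remains.  This gives a vector s of six sequences,
  with first entry proportional to r, and s(m+1) = A(m) s(m) for a matrix A of rational functions.

  Let L = sum_j z^j p_j(theta) be the operator found by linear algebra from the initial values of r.  Define
  row vectors by P_0 = (p_0, 0, ..., 0) and P_(j+1)(m) = P_j(m+1) A(m) + p_(j+1)(m) (1, 0, ..., 0).
  Remarkably they all have integer polynomial entries of degree at most 9, and P_24 = 0.  Telescoping then
  shows that L annihilates R in all degrees N >= 24; for N < 24 one needs P_N(0) s(0) = 0.  The recurrence is
  the same identity read off from coefficients.
*)

theory Submission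
  imports Defs
begin

section \<open>Reduction to coefficients of one-variable polynomials\<close>

text \<open>The algebra rests on one generating function: Q_n is the coefficient of t^n in exp(x t)
  / sqrt(1 - 4 t^2). Its x-derivative is multiplication by t and its logarithmic t-derivative is
  rational in t, so differentiation and shift close up on three consecutive Q_n. Likewise
  \<open>pe m\<close> is the coefficient of t^(m+2) in exp(x t) sqrt(1 - 4 t^2). The vector s
  contains q(m) and q(m+1), which up to explicit factors are r(m+1) and r(m+2). So besides three
  successive values of r it has only three auxiliary sequences a, b, c, and only four rows of A need
  work. The denominators of A have the factors m+1, m+2, m+3 and 2m+5, none of which vanishes at a
  natural number. The obstacle is size: iterating A up to r(m+24) would pile up numerators and
  denominators. Adding one p_j after each multiplication by A lets the denominators cancel at every
  step, so each step is a small identity between integer polynomials. The differential equation says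
  more than the recurrence: it includes the truncated relations with N < 24, and these depend on the
  initial vector.\<close>

definition ct_pow :: "nat \<Rightarrow> rat" where
  "ct_pow m = (if even m then of_nat (m choose (m div 2)) else 0)"

text \<open>The factors 1/a! are those of the multinomial coefficient in \<open>r45_eq\<close>,
  distributed over the five factors of \<open>Qpoly n ^ 5\<close>.\<close>

definition Qpoly :: "nat \<Rightarrow> rat poly" where
  "Qpoly n = (\<Sum>a\<le>n. monom (ct_pow (n - a) / fact a) a)"

lemma coeff_Qpoly: "coeff (Qpoly n) a = (if a \<le> n then ct_pow (n - a) / fact a else 0)"
  by (simp add: Qpoly_def coeff_sum)

section \<open>Constant terms of products of powers of the Y_j\<close>

lemma LX_power: "LX j ^ i = Poly_Mapping.single (Poly_Mapping.single j (int i)) 1"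
  by (induction i) (simp_all add: LX_def mult_single single_add[symmetric] add.commute)

lemma LXinv_power: "LXinv j ^ i = Poly_Mapping.single (Poly_Mapping.single j (- int i)) 1"
  by (induction i) (simp_all add: LXinv_def mult_single single_add[symmetric] single_uminus[symmetric] algebra_simps)

lemma LY_power: "LY j ^ m =
   (\<Sum>i\<le>m. Poly_Mapping.single (Poly_Mapping.single j (2 * int i - int m)) (of_nat (m choose i)))"
  unfolding LY_def binomial_ring LX_power LXinv_power
  by (intro sum.cong refl)
     (simp add: mult_single single_add[symmetric] of_nat_diff flip: single_of_nat)

lemma keys_LY_power: "k \<in> Poly_Mapping.keys (LY j ^ m) \<Longrightarrow> Poly_Mapping.keys k \<subseteq> {j}"
  unfolding LY_power using keys_sum by (fastforce split: if_splits)

text \<open>Exponent vectors form a group, so the convolution sum has the single term l = a, q' = k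
  - a.\<close>

lemma lookup_single_mult:
  "Poly_Mapping.lookup (Poly_Mapping.single a c * q) (k :: nat \<Rightarrow>\<^sub>0 int) = c * Poly_Mapping.lookup q (k - a)"
proof -
  have "Poly_Mapping.lookup (Poly_Mapping.single a c * q) k
      = Sum_any (\<lambda>l. (c when a = l) * Sum_any (\<lambda>q'. Poly_Mapping.lookup q q' when k = l + q'))"
    by (simp add: lookup_mult lookup_single)
  also have "\<dots> = Sum_any (\<lambda>l. c * Sum_any (\<lambda>q'. Poly_Mapping.lookup q q' when k = l + q') when l = a)"
    by (simp add: when_mult eq_commute[of a])
  also have "\<dots> = c * Sum_any (\<lambda>q'. Poly_Mapping.lookup q q' when q' = k - a)"
    by (simp add: eq_diff_eq add.commute eq_commute[of k])
  finally show ?thesis by simp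
qed

lemma keys_prod_LY:
  assumes "finite S" "k \<in> Poly_Mapping.keys (\<Prod>j\<in>S. LY j ^ e j)"
  shows "Poly_Mapping.keys k \<subseteq> S"
  using assms
proof (induction S arbitrary: k rule: finite_induct)
  case empty
  then show ?case by simp
next
  case (insert j S)
  then have "k \<in> Poly_Mapping.keys (LY j ^ e j * (\<Prod>j\<in>S. LY j ^ e j))" by simp
  then obtain a b where "k = a + b" "a \<in> Poly_Mapping.keys (LY j ^ e j)"
      "b \<in> Poly_Mapping.keys (\<Prod>j\<in>S. LY j ^ e j)"
    using keys_mult by blast
  then show ?case using keys_LY_power insert.IH keys_add[of a b] by fastforce
qed

text \<open>Each factor has a variable of its own. The rest of the product is free of X_j, so it
  meets only the X_j^0 term of \<open>LY j ^ e j\<close>: the middle binomial coefficient, absent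
  when \<open>e j\<close> is odd.\<close>

lemma CT_prod_LY:
  assumes "finite S"
  shows "of_int (CT (\<Prod>j\<in>S. LY j ^ e j)) = (\<Prod>j\<in>S. ct_pow (e j))"
  using assms
proof (induction S rule: finite_induct)
  case empty
  then show ?case by (simp add: CT_def lookup_one)
next
  case (insert j S)
  let ?q = "\<Prod>j\<in>S. LY j ^ e j" and ?m = "e j"
  have 0: "Poly_Mapping.lookup ?q (- Poly_Mapping.single j d) = (if d = 0 then CT ?q else 0)" for d :: int
  proof (cases "d = 0")
    case False
    \<comment> \<open>A nonzero d would put j among the variables of \<open>?q\<close>, which all
      lie in S.\<close>
    have "- Poly_Mapping.single j d \<notin> Poly_Mapping.keys ?q"
    proof
      assume "- Poly_Mapping.single j d \<in> Poly_Mapping.keys ?q"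
      from keys_prod_LY[OF insert.hyps(1) this] False insert.hyps(2) show False by simp
    qed
    with False show ?thesis by (simp add: in_keys_iff)
  qed (simp add: CT_def)
  have "CT (LY j ^ ?m * ?q) = (\<Sum>i\<le>?m. of_nat (?m choose i) * (if 2 * int i - int ?m = 0 then CT ?q else 0))"
    by (simp add: CT_def LY_power[of j ?m] sum_distrib_right lookup_sum lookup_single_mult 0[unfolded CT_def] cong: if_cong)
  also have "2 * int i - int ?m = 0 \<longleftrightarrow> even ?m \<and> i = ?m div 2" for i
    by presburger
  then have "(\<Sum>i\<le>?m. of_nat (?m choose i) * (if 2 * int i - int ?m = 0 then CT ?q else 0))
      = (\<Sum>i\<le>?m. if i = ?m div 2 then (if even ?m then of_nat (?m choose i) * CT ?q else 0) else 0)"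
    by (intro sum.cong refl) simp
  also have "\<dots> = (if even ?m then of_nat (?m choose (?m div 2)) * CT ?q else 0)"
    by (subst sum.delta) auto
  finally have "of_int (CT (LY j ^ ?m * ?q)) = ct_pow ?m * of_int (CT ?q)"
    by (simp add: ct_pow_def)
  then show ?case using insert by simp
qed

lemma CT_sum: "CT (sum f A) = (\<Sum>x\<in>A. CT (f x))"
  by (simp add: CT_def lookup_sum)

lemma CT_of_nat_mult: "CT (of_nat c * p) = of_nat c * CT p"
  by (induction c) (simp_all add: CT_def lookup_add distrib_right)

section \<open>Multinomial expansion and the formula for r(n)\<close>

lemma power_sum5:
  fixes a b c d e :: "'a::comm_ring_1"
  shows "(a + (b + (c + (d + e)))) ^ n =
    (\<Sum>i\<le>n. \<Sum>j\<le>n - i. \<Sum>k\<le>n - i - j. \<Sum>l\<le>n - i - j - k.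
      of_nat ((n choose i) * ((n - i) choose j) * ((n - i - j) choose k) * ((n - i - j - k) choose l))
       * (a ^ i * b ^ j * c ^ k * d ^ l * e ^ (n - i - j - k - l)))"
  by (simp add: binomial_ring sum_distrib_left sum_distrib_right mult_ac)

text \<open>The nested index sets are those of \<open>power_sum5\<close>, so \<open>r45_eq\<close>
  can compare the two sums term by term.\<close>

lemma coeff_power5:
  "coeff (p ^ 5) n = (\<Sum>i\<le>n. \<Sum>j\<le>n - i. \<Sum>k\<le>n - i - j. \<Sum>l\<le>n - i - j - k.
      coeff p i * coeff p j * coeff p k * coeff p l * coeff p (n - i - j - k - l))"
  for p :: "'a::comm_ring_1 poly"
proof -
  have "p ^ 5 = p * (p * (p * (p * p)))" by (simp add: eval_nat_numeral)
  then show ?thesis by (simp add: coeff_mult sum_distrib_left mult_ac)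
qed

lemma esym_5_4: "esym 5 4 y = (\<Prod>i\<in>{0..<5}-{0}. y i) + ((\<Prod>i\<in>{0..<5}-{1}. y i) +
   ((\<Prod>i\<in>{0..<5}-{2}. y i) + ((\<Prod>i\<in>{0..<5}-{3}. y i) + (\<Prod>i\<in>{0..<5}-{4}. y i))))"
proof -
  have "{S. S \<subseteq> {0..<5} \<and> card S = 4} = (\<lambda>j. {0..<5::nat} - {j}) ` {0..<5}"
  proof (intro equalityI subsetI)
    fix S assume "S \<in> {S. S \<subseteq> {0..<5::nat} \<and> card S = 4}"
    then have S: "S \<subseteq> {0..<5}" "card S = 4" by auto
    then have "card ({0..<5} - S) = 1" by (subst card_Diff_subset) (auto intro: finite_subset)
    then obtain j where "{0..<5} - S = {j}" by (auto simp: card_1_singleton_iff)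
    then have "S = {0..<5} - {j}" "j \<in> {0..<5}" using S by auto
    then show "S \<in> (\<lambda>j. {0..<5::nat} - {j}) ` {0..<5}" by blast
  qed auto
  moreover have "inj_on (\<lambda>j. {0..<5::nat} - {j}) {0..<5}" by (auto simp: inj_on_def)
  ultimately have "esym 5 4 y = (\<Sum>j\<in>{0..<5}. \<Prod>i\<in>{0..<5} - {j}. y i)"
    by (simp add: esym_def sum.reindex)
  then show ?thesis by (simp add: eval_nat_numeral)
qed

lemma prod_compl: "(\<Prod>i\<in>{0..<5::nat}-{0}. y i) = y 1 * y 2 * y 3 * (y 4 :: 'a::comm_ring_1)"
   "(\<Prod>i\<in>{0..<5::nat}-{1}. y i) = y 0 * y 2 * y 3 * y 4"
   "(\<Prod>i\<in>{0..<5::nat}-{2}. y i) = y 0 * y 1 * y 3 * y 4"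
   "(\<Prod>i\<in>{0..<5::nat}-{3}. y i) = y 0 * y 1 * y 2 * y 4"
   "(\<Prod>i\<in>{0..<5::nat}-{4}. y i) = y 0 * y 1 * y 2 * y 3"
proof -
  have *: "{0..<5::nat} = {0,1,2,3,4}" by auto
  show "(\<Prod>i\<in>{0..<5::nat}-{0}. y i) = y 1 * y 2 * y 3 * (y 4 :: 'a::comm_ring_1)"
   "(\<Prod>i\<in>{0..<5::nat}-{1}. y i) = y 0 * y 2 * y 3 * y 4"
   "(\<Prod>i\<in>{0..<5::nat}-{2}. y i) = y 0 * y 1 * y 3 * y 4"
   "(\<Prod>i\<in>{0..<5::nat}-{3}. y i) = y 0 * y 1 * y 2 * y 4"
   "(\<Prod>i\<in>{0..<5::nat}-{4}. y i) = y 0 * y 1 * y 2 * y 3"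
    unfolding * by (simp_all add: insert_Diff_if mult_ac)
qed

lemma r45_eq: "of_int (r45 n) = fact n * coeff (Qpoly n ^ 5) n"
proof -
  let ?a = "\<lambda>j. \<Prod>i\<in>{0..<5}-{j}. LY i"
  have summand: "of_int (CT (of_nat ((n choose i) * ((n - i) choose j) * ((n - i - j) choose k) * ((n - i - j - k) choose l))
       * (?a 0 ^ i * ?a 1 ^ j * ?a 2 ^ k * ?a 3 ^ l * ?a 4 ^ (n - i - j - k - l))))
      = fact n * (coeff (Qpoly n) i * coeff (Qpoly n) j * coeff (Qpoly n) k * coeff (Qpoly n) l * coeff (Qpoly n) (n - i - j - k - l))"
    if le: "i \<le> n" "j \<le> n - i" "k \<le> n - i - j" "l \<le> n - i - j - k" for i j k l
  proof -
    define h where "h = n - i - j - k - l"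
    have n: "n = i + (j + (k + (l + h)))" using le by (simp add: h_def)
    \<comment> \<open>Only summand s of sigma_4 lacks the factor Y_s, so the exponent of Y_s is n
      minus the multiplicity of that summand.\<close>
    let ?e = "\<lambda>s. n - [i, j, k, l, h] ! s"
    have "?a 0 ^ i * ?a 1 ^ j * ?a 2 ^ k * ?a 3 ^ l * ?a 4 ^ h = (\<Prod>s\<in>{0,1,2,3,4}. LY s ^ ?e s)"
      unfolding prod_compl by (simp add: n power_mult_distrib power_add mult_ac)
    moreover have "of_int (CT (\<Prod>s\<in>{0,1,2,3,4}. LY s ^ ?e s)) = (\<Prod>s\<in>{0,1,2,3,4}. ct_pow (?e s))"
      by (rule CT_prod_LY) simp
    ultimately have ct: "of_int (CT (?a 0 ^ i * ?a 1 ^ j * ?a 2 ^ k * ?a 3 ^ l * ?a 4 ^ h))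
        = ct_pow (n - i) * ct_pow (n - j) * ct_pow (n - k) * ct_pow (n - l) * ct_pow (n - h)"
      by (simp add: mult_ac)
    \<comment> \<open>The product of binomials telescopes to the multinomial coefficient; each 1/i!
      joins \<open>ct_pow (n - i)\<close> to form a coefficient of \<open>Qpoly n\<close>.\<close>
    have multi: "(of_nat ((n choose i) * ((n - i) choose j) * ((n - i - j) choose k) * ((n - i - j - k) choose l)) :: rat)
        = fact n / (fact i * fact j * fact k * fact l * fact h)"
      by (simp add: n binomial_fact)
    have "j \<le> n" "k \<le> n" "l \<le> n" using le by linarith+
    then show ?thesis
      unfolding CT_of_nat_mult of_int_mult of_int_of_nat_eq multi h_def[symmetric] ct
      using le by (simp add: coeff_Qpoly h_def)
  qed
  have "of_int (r45 n) = (\<Sum>i\<le>n. \<Sum>j\<le>n - i. \<Sum>k\<le>n - i - j. \<Sum>l\<le>n - i - j - k.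
     of_int (CT (of_nat ((n choose i) * ((n - i) choose j) * ((n - i - j) choose k) * ((n - i - j - k) choose l))
       * (?a 0 ^ i * ?a 1 ^ j * ?a 2 ^ k * ?a 3 ^ l * ?a 4 ^ (n - i - j - k - l)))) :: rat)"
    unfolding r45_def esym_5_4 power_sum5 CT_sum of_int_sum ..
  also have "\<dots> = fact n * coeff (Qpoly n ^ 5) n"
    unfolding coeff_power5 sum_distrib_left
    by (intro sum.cong refl summand) auto
  finally show ?thesis .
qed
text \<open>Coefficient form of (1 - 4 t^2) y' = 4 t y for y = 1 / sqrt(1 - 4 t^2). For odd m both
  sides are 0.\<close>

lemma ct_pow_rec: "of_nat (m + 2) * ct_pow (m + 2) = 4 * of_nat (m + 1) * ct_pow m"
proof (cases "even m")
  case True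
  then obtain k where k: "m = 2 * k" by blast
  \<comment> \<open>The absorption identity is applied twice, each time consuming one factor
    \<open>Suc k\<close>; the surplus factor is cancelled afterwards.\<close>
  have "Suc k * (Suc k * (2 * Suc k choose Suc k)) = Suc k * (2 * (2 * k + 1) * (2 * k choose k))"
  proof -
    have 1: "Suc k * (2 * Suc k choose Suc k) = (2 * Suc k) * (2 * k + 1 choose k)"
      using Suc_times_binomial_eq[of "2*k+1" k] by (simp add: mult.commute)
    have 2: "Suc k * (2 * k + 1 choose k) = (2 * k + 1) * (2 * k choose k)"
    proof -
      have "(2 * k + 1 choose k) = (2 * k + 1 choose Suc k)"
        using binomial_symmetric[of k "2*k+1"] by simp
      then show ?thesis using Suc_times_binomial_eq[of "2*k" k] by (simp add: mult.commute)
    qed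
    have "Suc k * (Suc k * (2 * Suc k choose Suc k)) = (2 * Suc k) * (Suc k * (2 * k + 1 choose k))"
      unfolding 1 by (simp only: ac_simps)
    then show ?thesis unfolding 2 by (simp only: ac_simps)
  qed
  then have "Suc k * (2 * Suc k choose Suc k) = 2 * (2 * k + 1) * (2 * k choose k)"
    by (simp only: Suc_mult_cancel1)
  then have "(of_nat (Suc k * (2 * Suc k choose Suc k)) :: rat) = of_nat (2 * (2 * k + 1) * (2 * k choose k))"
    by (rule arg_cong)
  then show ?thesis by (simp add: ct_pow_def k algebra_simps)
qed (simp add: ct_pow_def)

lemma mult_divide_fact_Suc: "of_nat (Suc a) * c / fact (Suc a) = (c / fact a :: rat)"
  by (simp add: fact_Suc del: of_nat_Suc)

lemma pderiv_Qpoly: "pderiv (Qpoly (Suc n)) = Qpoly n"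
  by (rule poly_eqI) (simp add: coeff_pderiv coeff_Qpoly mult_divide_fact_Suc del: of_nat_Suc fact_Suc)

section \<open>Degree-five monomials under derivation and shift\<close>

text \<open>In the basis e, f, g the operator x d/dx has the constant eigenvalues 0 and \<open>\<plusminus>1/2\<close> in its leading part,
  which keeps all later coefficients small.\<close>

definition px :: "rat poly" where "px = [:0, 1:]"

definition pe :: "nat \<Rightarrow> rat poly" where "pe m = Qpoly (m + 2) - smult 4 (Qpoly m)"

definition pf :: "nat \<Rightarrow> rat poly" where "pf m = Qpoly (m + 1)"

definition pg :: "nat \<Rightarrow> rat poly" where "pg m = smult 2 (Qpoly m)"

lemma coeff_px_mult: "coeff (px * p) n = (if n = 0 then 0 else coeff p (n - 1))"
  by (cases n) (simp_all add: px_def)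

lemma coeff_px_pderiv: "coeff (px * pderiv p) n = of_nat n * coeff p n"
  by (cases n) (simp_all add: px_def coeff_pderiv)

lemma deriv_f: "px * pderiv (pf m) = smult (1/2) (px * pg m)"
  by (simp add: pf_def pg_def pderiv_Qpoly)

text \<open>With k = m - a and c = \<open>ct_pow\<close> this is (k+2) (c(k+2) - 4 c(k)) = -4 c(k),
  a form of \<open>ct_pow_rec\<close>. For a = m + 1 the coefficient of \<open>pe m\<close>
  vanishes, and for a = m + 2 the two factors m + 2 and a agree.\<close>

lemma coeff_e: "of_nat (m + 2) * coeff (pe m) a =
   of_nat a * coeff (pe m) a - (if a \<le> m then 4 * coeff (Qpoly m) a else 0)"
proof -
  consider "a \<le> m" | "a = m + 1" | "a = m + 2" | "a > m + 2" by linarith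
  then show ?thesis
  proof cases
    case 1
    then obtain k where k: "m = a + k" by (auto simp: le_iff_add)
    have "of_nat (k+2) * ct_pow (k + 2) = 4 * of_nat (k + 1) * ct_pow k" by (rule ct_pow_rec)
    then have *: "(of_nat m + 2) * ct_pow (k+2) = of_nat a * ct_pow (k+2) + 4 * of_nat (k + 1) * ct_pow k"
      by (simp add: k algebra_simps)
    show ?thesis using * by (simp add: pe_def coeff_Qpoly k field_simps)
  qed (simp_all add: pe_def coeff_Qpoly ct_pow_def)
qed

lemma deriv_e: "px * pderiv (pe m) = smult (of_nat (m + 2)) (pe m) + smult 2 (pg m)"
proof (rule poly_eqI)
  fix n show "coeff (px * pderiv (pe m)) n = coeff (smult (of_nat (m + 2)) (pe m) + smult 2 (pg m)) n"
    using coeff_e[of m n] by (auto simp: coeff_px_pderiv pg_def coeff_Qpoly split: if_splits)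
qed

text \<open>Since Q_(m+2)' = Q_(m+1), x d/dx sends Q_(m+2) = e + 2 g to x f. With x e' known from
  \<open>deriv_e\<close>, this determines x g'.\<close>

lemma deriv_g: "px * pderiv (pg m) =
    smult (1/2) (px * pf m) - smult (of_nat (m + 2) / 2) (pe m) - pg m"
proof (rule poly_eqI)
  fix n
  have "coeff (px * pf m) n = of_nat n * coeff (Qpoly (m + 2)) n"
    by (cases n) (simp_all add: coeff_px_mult pf_def coeff_Qpoly mult_divide_fact_Suc del: of_nat_Suc fact_Suc)
  moreover have "coeff (Qpoly (m + 2)) n = coeff (pe m) n + 4 * coeff (Qpoly m) n"
    by (simp add: pe_def)
  ultimately show "coeff (px * pderiv (pg m)) n = coeff (smult (1/2) (px * pf m) - smult (of_nat (m + 2) / 2) (pe m) - pg m) n"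
    using coeff_e[of m n]
    by (auto simp: coeff_px_pderiv pg_def coeff_Qpoly field_simps split: if_splits)
qed

lemma shift_g: "pg (Suc m) = 2 * pf m"
  by (simp add: pg_def pf_def numeral_poly)

lemma shift_f: "pf (Suc m) = pe m + 2 * pg m"
  by (simp add: pg_def pf_def pe_def numeral_poly)

text \<open>The derivative of \<open>pe (Suc m)\<close> is \<open>pe m\<close>, so
  \<open>deriv_e\<close> at m + 1, solved for \<open>pe (Suc m)\<close>, is already the shift. Among
  the three shifts it alone brings in a denominator.\<close>

lemma shift_e: "smult (of_nat (m + 3)) (pe (Suc m)) = px * pe m - 4 * pf m"
proof -
  have "smult (of_nat (m + 3)) (pe (Suc m)) = px * pderiv (pe (Suc m)) - smult 2 (pg (Suc m))"
    using deriv_e[of "Suc m"] by (simp add: numeral_3_eq_3)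
  also have "pderiv (pe (Suc m)) = pe m"
    by (simp add: pe_def pderiv_diff pderiv_smult pderiv_Qpoly)
  finally show ?thesis by (simp add: shift_g numeral_poly)
qed

text \<open>Fixing the coefficient of x^(m+2) puts three shifts on a common footing: a sequence
  taken at m, m + 1 or m + 2 gets an extra factor x^2, x or 1. Only a + b + c = 5 occurs, and i + b
  is even, since by parity of Q_n the other coefficients vanish.\<close>

definition mcoef :: "nat \<Rightarrow> nat \<Rightarrow> nat \<Rightarrow> nat \<Rightarrow> nat \<Rightarrow> rat" where
  "mcoef m i a b c = coeff (px ^ i * pe m ^ a * pf m ^ b * pg m ^ c) (m + 2)"

text \<open>The coefficient of \<open>x^(m+2)\<close> in \<open>(x d/dx - (m+2)) F\<close> for the monomial F, written out by the product rule.
  The truncated differences are harmless: each is multiplied by the exponent that it decreases.\<close>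

definition mrel :: "nat \<Rightarrow> nat \<Rightarrow> nat \<Rightarrow> nat \<Rightarrow> nat \<Rightarrow> rat" where
  "mrel m i a b c = (of_nat i + of_nat a * of_nat (m + 2) - of_nat c - of_nat (m + 2)) * mcoef m i a b c
     + 2 * of_nat a * mcoef m i (a - 1) b (c + 1)
     + of_nat b / 2 * mcoef m (i + 1) a (b - 1) (c + 1)
     + of_nat c / 2 * mcoef m (i + 1) a (b + 1) (c - 1)
     - of_nat c * of_nat (m + 2) / 2 * mcoef m i (a + 1) b (c - 1)"

lemma px_pderiv_power: "px * pderiv (p ^ k) = smult (of_nat k) (p ^ (k - 1) * (px * pderiv p))"
  by (simp add: pderiv_power ac_simps)

lemma pderiv_px: "px * pderiv px = px"
  by (simp add: px_def pderiv_pCons)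

lemma mrel_zero: "mrel m i a b c = 0"
proof -
  let ?x = px and ?e = "pe m" and ?f = "pf m" and ?g = "pg m"
  let ?F = "?x ^ i * ?e ^ a * ?f ^ b * ?g ^ c"
  have "px * pderiv ?F = (px * pderiv (?x ^ i)) * ?e ^ a * ?f ^ b * ?g ^ c
     + ?x ^ i * (px * pderiv (?e ^ a)) * ?f ^ b * ?g ^ c
     + ?x ^ i * ?e ^ a * (px * pderiv (?f ^ b)) * ?g ^ c
     + ?x ^ i * ?e ^ a * ?f ^ b * (px * pderiv (?g ^ c))"
    by (simp add: pderiv_mult algebra_simps)
  also have "(px * pderiv (?x ^ i)) * ?e ^ a * ?f ^ b * ?g ^ c = smult (of_nat i) ?F"
    unfolding px_pderiv_power pderiv_px by (cases i) (simp_all add: algebra_simps)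
  also have "?x ^ i * (px * pderiv (?e ^ a)) * ?f ^ b * ?g ^ c =
      smult (of_nat a * of_nat (m + 2)) ?F
      + smult (2 * of_nat a) (?x ^ i * ?e ^ (a - 1) * ?f ^ b * ?g ^ (c + 1))"
    unfolding px_pderiv_power deriv_e by (cases a) (simp_all add: algebra_simps smult_add_right)
  also have "?x ^ i * ?e ^ a * (px * pderiv (?f ^ b)) * ?g ^ c =
      smult (of_nat b / 2) (?x ^ (i + 1) * ?e ^ a * ?f ^ (b - 1) * ?g ^ (c + 1))"
    unfolding px_pderiv_power deriv_f by (cases b) (simp_all add: algebra_simps)
  also have "?x ^ i * ?e ^ a * ?f ^ b * (px * pderiv (?g ^ c)) =
      smult (of_nat c / 2) (?x ^ (i + 1) * ?e ^ a * ?f ^ (b + 1) * ?g ^ (c - 1))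
      - smult (of_nat c * of_nat (m + 2) / 2) (?x ^ i * ?e ^ (a + 1) * ?f ^ b * ?g ^ (c - 1))
      - smult (of_nat c) ?F"
    unfolding px_pderiv_power deriv_g by (cases c) (simp_all add: algebra_simps smult_add_right smult_diff_right)
  finally show ?thesis
    by (drule_tac f = "\<lambda>p. coeff p (m + 2)" in arg_cong)
       (simp add: coeff_px_pderiv mrel_def mcoef_def algebra_simps del: power_Suc)
qed

lemma coeff_numeral_mult: "coeff (numeral k * p) n = numeral k * coeff p n"
  by (simp add: numeral_poly)

text \<open>Equal to 32 r(m) / m!, because \<open>pg\<close> is twice \<open>Qpoly\<close>.\<close>

definition seq_r :: "nat \<Rightarrow> rat" where "seq_r m = coeff (pg m ^ 5) m"

definition seq_q :: "nat \<Rightarrow> rat" where "seq_q m = coeff (pf m ^ 4 * pg m) m"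

definition seq_a :: "nat \<Rightarrow> rat" where "seq_a m = coeff (pf m ^ 2 * pg m ^ 3) m"

text \<open>Put u = f + g and v = f - g, the eigenvectors of the leading part of x d/dx for 1/2 and
  -1/2. Then b and c span the coefficients of e (u^4 + v^4) and e u v (u^2 + v^2). The remaining
  even quartic, e u^2 v^2 = e (f^2 - g^2)^2, has eigenvalue 0; its relation appears in the row
  proofs as three \<open>mrel\<close> terms in the ratio 1 : -2 : 1.\<close>

definition seq_b :: "nat \<Rightarrow> rat" where "seq_b m = coeff (pe m * (pg m ^ 4 + 3 * pf m ^ 2 * pg m ^ 2)) m"

definition seq_c :: "nat \<Rightarrow> rat" where "seq_c m = coeff (pe m * (pf m ^ 4 + 3 * pf m ^ 2 * pg m ^ 2)) m"

lemma seq_mcoef: "seq_r m = mcoef m 2 0 0 5" "seq_q m = mcoef m 2 0 4 1" "seq_a m = mcoef m 2 0 2 3"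
  "seq_b m = mcoef m 2 1 0 4 + 3 * mcoef m 2 1 2 2" "seq_c m = mcoef m 2 1 4 0 + 3 * mcoef m 2 1 2 2"
  by (simp_all add: seq_r_def seq_q_def seq_a_def seq_b_def seq_c_def mcoef_def power2_eq_square coeff_px_mult
      coeff_numeral_mult mult.assoc distrib_left mult.left_commute[of _ "numeral k" for k])

section \<open>Shifted sequences written in monomials at m\<close>

lemma exp_q1: "seq_q (m + 1) =
   32 * mcoef m 1 0 1 4 + 64 * mcoef m 1 1 1 3 + 48 * mcoef m 1 2 1 2 + 16 * mcoef m 1 3 1 1 + 2 * mcoef m 1 4 1 0"
proof -
  have "seq_q (m + 1) = coeff (px * ((pe m + 2 * pg m) ^ 4 * (2 * pf m))) (m + 2)"
    by (simp add: seq_q_def coeff_px_mult shift_f shift_g)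
  also have "px * ((pe m + 2 * pg m) ^ 4 * (2 * pf m)) =
     32 * (px ^ 1 * pe m ^ 0 * pf m ^ 1 * pg m ^ 4) + 64 * (px ^ 1 * pe m ^ 1 * pf m ^ 1 * pg m ^ 3) + 48 * (px ^
       1 * pe m ^ 2 * pf m ^ 1 * pg m ^ 2) + 16 * (px ^ 1 * pe m ^ 3 * pf m ^ 1 * pg m ^ 1) + 2 * (px ^ 1 * pe m
       ^ 4 * pf m ^ 1 * pg m ^ 0)"
    by algebra
  finally show ?thesis by (simp add: mcoef_def coeff_numeral_mult)
qed
lemma exp_a1: "seq_a (m + 1) =
   32 * mcoef m 1 0 3 2 + 32 * mcoef m 1 1 3 1 + 8 * mcoef m 1 2 3 0"
proof -
  have "seq_a (m + 1) = coeff (px * ((pe m + 2 * pg m) ^ 2 * (2 * pf m) ^ 3)) (m + 2)"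
    by (simp add: seq_a_def coeff_px_mult shift_f shift_g)
  also have "px * ((pe m + 2 * pg m) ^ 2 * (2 * pf m) ^ 3) =
     32 * (px ^ 1 * pe m ^ 0 * pf m ^ 3 * pg m ^ 2) + 32 * (px ^ 1 * pe m ^ 1 * pf m ^ 3 * pg m ^ 1) + 8 * (px ^
       1 * pe m ^ 2 * pf m ^ 3 * pg m ^ 0)"
    by algebra
  finally show ?thesis by (simp add: mcoef_def coeff_numeral_mult)
qed
text \<open>The factor m + 3 clears the denominator of \<open>shift_e\<close>, which is needed once
  because the polynomial is linear in e.\<close>

lemma exp_b1: "(of_nat m + 3) * seq_b (m + 1) =
   48 * mcoef m 2 1 2 2 + 16 * mcoef m 2 1 4 0 + 48 * mcoef m 2 2 2 1 + 12 * mcoef m 2 3 2 0 - 192 * mcoef m 1 0 3 2 - 64 * mcoef m 1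
     0 5 0 - 192 * mcoef m 1 1 3 1 - 48 * mcoef m 1 2 3 0"
proof -
  have "(of_nat m + 3) * seq_b (m + 1) = coeff (px * ((px * pe m - 4 * pf m) * ((2 * pf m) ^ 4 + 3 * (pe m + 2 * pg m) ^ 2 * (2 * pf m) ^ 2))) (m + 2)"
    proof -
    have "(of_nat m + 3) * seq_b (m + 1) = coeff (smult (of_nat (m + 3)) (pe (Suc m)) * (pg (Suc m) ^ 4 + 3 * pf (Suc m) ^ 2 * pg (Suc m) ^ 2)) (m + 1)"
      by (simp add: seq_b_def add.commute)
    then show ?thesis unfolding shift_e by (simp add: coeff_px_mult shift_f shift_g)
  qed
  also have "px * ((px * pe m - 4 * pf m) * ((2 * pf m) ^ 4 + 3 * (pe m + 2 * pg m) ^ 2 * (2 * pf m) ^ 2)) =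
     48 * (px ^ 2 * pe m ^ 1 * pf m ^ 2 * pg m ^ 2) + 16 * (px ^ 2 * pe m ^ 1 * pf m ^ 4 * pg m ^ 0) + 48 * (px ^
       2 * pe m ^ 2 * pf m ^ 2 * pg m ^ 1) + 12 * (px ^ 2 * pe m ^ 3 * pf m ^ 2 * pg m ^ 0) - 192 * (px ^ 1 * pe
       m ^ 0 * pf m ^ 3 * pg m ^ 2) - 64 * (px ^ 1 * pe m ^ 0 * pf m ^ 5 * pg m ^ 0) - 192 * (px ^ 1 * pe m ^ 1
       * pf m ^ 3 * pg m ^ 1) - 48 * (px ^ 1 * pe m ^ 2 * pf m ^ 3 * pg m ^ 0)"
    by algebra
  finally show ?thesis by (simp add: mcoef_def coeff_numeral_mult)
qed
lemma exp_c1: "(of_nat m + 3) * seq_c (m + 1) =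
   16 * mcoef m 2 1 0 4 + 48 * mcoef m 2 1 2 2 + 32 * mcoef m 2 2 0 3 + 48 * mcoef m 2 2 2 1 + 24 * mcoef m 2 3 0 2 + 12 * mcoef m 2 3
     2 0 + 8 * mcoef m 2 4 0 1 + mcoef m 2 5 0 0 - 64 * mcoef m 1 0 1 4 - 192 * mcoef m 1 0 3 2 - 128 * mcoef m 1 1 1 3 - 192 * mcoef
     m 1 1 3 1 - 96 * mcoef m 1 2 1 2 - 48 * mcoef m 1 2 3 0 - 32 * mcoef m 1 3 1 1 - 4 * mcoef m 1 4 1 0"
proof -
  have "(of_nat m + 3) * seq_c (m + 1) = coeff (px * ((px * pe m - 4 * pf m) * ((pe m + 2 * pg m) ^ 4 + 3 * (pe m + 2 * pg m) ^ 2 * (2 * pf m) ^ 2))) (m + 2)"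
    proof -
    have "(of_nat m + 3) * seq_c (m + 1) = coeff (smult (of_nat (m + 3)) (pe (Suc m)) * (pf (Suc m) ^ 4 + 3 * pf (Suc m) ^ 2 * pg (Suc m) ^ 2)) (m + 1)"
      by (simp add: seq_c_def add.commute)
    then show ?thesis unfolding shift_e by (simp add: coeff_px_mult shift_f shift_g)
  qed
  also have "px * ((px * pe m - 4 * pf m) * ((pe m + 2 * pg m) ^ 4 + 3 * (pe m + 2 * pg m) ^ 2 * (2 * pf m) ^ 2)) =
     16 * (px ^ 2 * pe m ^ 1 * pf m ^ 0 * pg m ^ 4) + 48 * (px ^ 2 * pe m ^ 1 * pf m ^ 2 * pg m ^ 2) + 32 * (px ^
       2 * pe m ^ 2 * pf m ^ 0 * pg m ^ 3) + 48 * (px ^ 2 * pe m ^ 2 * pf m ^ 2 * pg m ^ 1) + 24 * (px ^ 2 * pe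
       m ^ 3 * pf m ^ 0 * pg m ^ 2) + 12 * (px ^ 2 * pe m ^ 3 * pf m ^ 2 * pg m ^ 0) + 8 * (px ^ 2 * pe m ^ 4 *
       pf m ^ 0 * pg m ^ 1) + (px ^ 2 * pe m ^ 5 * pf m ^ 0 * pg m ^ 0) - 64 * (px ^ 1 * pe m ^ 0 * pf m ^ 1 *
       pg m ^ 4) - 192 * (px ^ 1 * pe m ^ 0 * pf m ^ 3 * pg m ^ 2) - 128 * (px ^ 1 * pe m ^ 1 * pf m ^ 1 * pg m
       ^ 3) - 192 * (px ^ 1 * pe m ^ 1 * pf m ^ 3 * pg m ^ 1) - 96 * (px ^ 1 * pe m ^ 2 * pf m ^ 1 * pg m ^ 2) -
       48 * (px ^ 1 * pe m ^ 2 * pf m ^ 3 * pg m ^ 0) - 32 * (px ^ 1 * pe m ^ 3 * pf m ^ 1 * pg m ^ 1) - 4 * (px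
       ^ 1 * pe m ^ 4 * pf m ^ 1 * pg m ^ 0)"
    by algebra
  finally show ?thesis by (simp add: mcoef_def coeff_numeral_mult)
qed

lemma const_poly_power: "[:c:] ^ k = [:c ^ k:]"
  by (induction k) (simp_all add: one_pCons mult.commute)

text \<open>As q(m+1) is itself an entry of the vector, its successor q(m+2) is needed to close the
  system. Two shifts of f give (m+3) f_(m+2) = x e + 4 (m+2) f, and f enters to the fourth power,
  whence (m+3)^4.\<close>

lemma exp_q2: "(of_nat m + 3) ^ 4 * seq_q (m + 2) =
   2 * mcoef m 4 5 0 0 + 4 * mcoef m 4 4 0 1 + 32 * (of_nat m + 2) * mcoef m 3 4 1 0 + 64 * (of_nat m + 2) * mcoef m 3 3 1 1 +
     192 * (of_nat m + 2) ^ 2 * mcoef m 2 3 2 0 + 384 * (of_nat m + 2) ^ 2 * mcoef m 2 2 2 1 + 512 * (of_nat m + 2) ^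
     3 * mcoef m 1 2 3 0 + 1024 * (of_nat m + 2) ^ 3 * mcoef m 1 1 3 1 + 512 * (of_nat m + 2) ^ 4 * mcoef m 0 1 4 0 + 1024
     * (of_nat m + 2) ^ 4 * mcoef m 0 0 4 1"
proof -
  have f2: "smult (of_nat m + 3) (pf (Suc (Suc m))) = px * pe m + 4 * [:of_nat m + 2:] * pf m"
  proof -
    have "smult (of_nat m + 3) (pf (Suc (Suc m))) = smult (of_nat (m + 3)) (pe (Suc m)) + 4 * [:of_nat (m + 3):] * pf m"
      by (simp add: shift_f[of "Suc m"] shift_g smult_add_right add.commute numeral_poly)
    also have "\<dots> = px * pe m + 4 * [:of_nat m + 2:] * pf m"
      unfolding shift_e by (rule poly_eqI) (simp add: numeral_poly algebra_simps)
    finally show ?thesis .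
  qed
  have "(of_nat m + 3) ^ 4 * seq_q (m + 2) = coeff (smult ((of_nat m + 3) ^ 4) (pf (Suc (Suc m)) ^ 4) * pg (Suc (Suc m))) (m + 2)"
    by (simp add: seq_q_def)
  also have "smult ((of_nat m + 3) ^ 4) (pf (Suc (Suc m)) ^ 4) = (px * pe m + 4 * [:of_nat m + 2:] * pf m) ^ 4"
    by (simp only: smult_power[symmetric] f2)
  also have "pg (Suc (Suc m)) = 2 * (pe m + 2 * pg m)"
    by (simp only: shift_g shift_f)
  \<comment> \<open>The scalar m + 2 stays a constant polynomial here, so that
    \<open>algebra\<close> can treat it as one more ring element.\<close>
  also have "(px * pe m + 4 * [:of_nat m + 2:] * pf m) ^ 4 * (2 * (pe m + 2 * pg m)) =
     2 * ((px ^ 4 * pe m ^ 5 * pf m ^ 0 * pg m ^ 0)) + 4 * ((px ^ 4 * pe m ^ 4 * pf m ^ 0 * pg m ^ 1)) + 32 *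
       ([:of_nat m + 2:] * (px ^ 3 * pe m ^ 4 * pf m ^ 1 * pg m ^ 0)) + 64 * ([:of_nat m + 2:] * (px ^ 3 * pe m
       ^ 3 * pf m ^ 1 * pg m ^ 1)) + 192 * ([:of_nat m + 2:] ^ 2 * (px ^ 2 * pe m ^ 3 * pf m ^ 2 * pg m ^ 0)) +
       384 * ([:of_nat m + 2:] ^ 2 * (px ^ 2 * pe m ^ 2 * pf m ^ 2 * pg m ^ 1)) + 512 * ([:of_nat m + 2:] ^ 3 *
       (px ^ 1 * pe m ^ 2 * pf m ^ 3 * pg m ^ 0)) + 1024 * ([:of_nat m + 2:] ^ 3 * (px ^ 1 * pe m ^ 1 * pf m ^ 3
       * pg m ^ 1)) + 512 * ([:of_nat m + 2:] ^ 4 * (px ^ 0 * pe m ^ 1 * pf m ^ 4 * pg m ^ 0)) + 1024 *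
       ([:of_nat m + 2:] ^ 4 * (px ^ 0 * pe m ^ 0 * pf m ^ 4 * pg m ^ 1))"
    by algebra
  finally show ?thesis
    by (simp add: mcoef_def coeff_numeral_mult const_poly_power, simp add: algebra_simps)
qed

section \<open>The first-order system\<close>

text \<open>The multipliers of \<open>mrel\<close> in the proofs below solve a linear system over \<open>Q(n)\<close> that expresses each
  shifted sequence through the six basis sequences.\<close>

lemma row_a1:
  fixes m :: nat defines "n \<equiv> of_nat m :: rat"
  shows "(n + 2) * seq_a (m + 1) =
     (48) * seq_a m + (8) * seq_c m + (32) * seq_q m" (is "?l = ?r")
proof -
  have "?l - ?r =
     (- 32) * mrel m 1 0 3 2 + (- 16) * mrel m 1 1 3 1"
    unfolding exp_a1[of m, folded n_def] by (simp add: seq_mcoef mrel_def n_def[symmetric] numeral_2_eq_2[symmetric]) algebra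
  then show ?thesis by (simp add: mrel_zero)
qed

lemma row_b1:
  fixes m :: nat defines "n \<equiv> of_nat m :: rat"
  shows "(2 * n + 5) * (n + 2) * (n + 1) * ((n + 3) * seq_b (m + 1)) =
     (- 2568 - 6648 * n - 5616 * n^2 - 1536 * n^3) * seq_a m + (- 1716 - 3612 * n - 2424 * n^2 - 528 * n^3) * seq_b
       m + (1636 + 3276 * n + 2040 * n^2 + 400 * n^3) * seq_c m + (- 140 + 892 * n + 552 * n^2) * seq_q m + (216 +
       528 * n + 462 * n^2 + 174 * n^3 + 24 * n^4) * seq_q (m + 1) + (- 1932 - 3684 * n - 2136 * n^2 - 384 * n^3)
       * seq_r m" (is "?l = ?r")
proof -
  have "?l - ?r =
     (3072 + 6144 * n + 3840 * n^2 + 768 * n^3) * mrel m 1 0 1 4 + (- 1856 - 2944 * n - 1088 * n^2) * mrel m 1 0 3 2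
       + (640 + 576 * n + 128 * n^2) * mrel m 1 0 5 0 + (198 + 306 * n + 108 * n^2) * mrel m 2 1 0 4 + (4224 + 8448
       * n + 5280 * n^2 + 1056 * n^3) * mrel m 1 1 1 3 + (- 396 - 612 * n - 216 * n^2) * mrel m 2 1 2 2 + (- 3744 -
       7168 * n - 4160 * n^2 - 736 * n^3) * mrel m 1 1 3 1 + (198 + 306 * n + 108 * n^2) * mrel m 2 1 4 0 + (1728 +
       3456 * n + 2160 * n^2 + 432 * n^3) * mrel m 1 2 1 2 + (- 1408 - 2848 * n - 1808 * n^2 - 368 * n^3) * mrel m 1
       2 3 0 + (- 12 - 18 * n - 6 * n^2) * mrel m 2 3 0 2 + (96 + 192 * n + 120 * n^2 + 24 * n^3) * mrel m 1 3 1 1 +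
       (12 + 18 * n + 6 * n^2) * mrel m 2 3 2 0 + (- 48 - 96 * n - 60 * n^2 - 12 * n^3) * mrel m 1 4 1 0"
    \<comment> \<open>The basis element \<open>seq_q (m + 1)\<close> on the right must be expanded
      into monomials too, hence \<open>exp_q1\<close>.\<close>
    unfolding exp_b1[of m, folded n_def] exp_q1 by (simp add: seq_mcoef mrel_def n_def[symmetric] numeral_2_eq_2[symmetric]) algebra
  then show ?thesis by (simp add: mrel_zero)
qed

lemma row_c1:
  fixes m :: nat defines "n \<equiv> of_nat m :: rat"
  shows "6 * (2 * n + 5) * (n + 2) * ((n + 3) * seq_c (m + 1)) =
     (5328 + 38304 * n + 18432 * n^2) * seq_a m + (19176 + 21456 * n + 6048 * n^2) * seq_b m + (- 22056 - 19696 * n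
       - 4384 * n^2) * seq_c m + (- 34600 - 17584 * n) * seq_q m + (- 2916 - 4038 * n - 1866 * n^2 - 288 * n^3) * seq_q
       (m + 1) + (21912 + 20400 * n + 4608 * n^2) * seq_r m" (is "?l = ?r")
proof -
  have "?l - ?r =
     (- 35712 - 36288 * n - 9216 * n^2) * mrel m 1 0 1 4 + (38656 + 19840 * n) * mrel m 1 0 3 2 + (- 2028 - 1128 *
       n) * mrel m 2 1 0 4 + (- 44544 - 45696 * n - 11712 * n^2) * mrel m 1 1 1 3 + (4056 + 2256 * n) * mrel m 2 1 2 2
       + (52224 + 43904 * n + 8768 * n^2) * mrel m 1 1 3 1 + (- 2028 - 1128 * n) * mrel m 2 1 4 0 + (- 13248 - 14112
       * n - 3744 * n^2) * mrel m 1 2 1 2 + (16448 + 16992 * n + 4384 * n^2) * mrel m 1 2 3 0 + (72 + 36 * n) * mrel m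
       2 3 0 2 + (2304 + 2016 * n + 432 * n^2) * mrel m 1 3 1 1 + (- 72 - 36 * n) * mrel m 2 3 2 0 + (1128 + 1092 *
       n + 264 * n^2) * mrel m 1 4 1 0 + (6 + 3 * n) * mrel m 2 5 0 0"
    unfolding exp_c1[of m, folded n_def] exp_q1 by (simp add: seq_mcoef mrel_def n_def[symmetric] numeral_2_eq_2[symmetric]) algebra
  then show ?thesis by (simp add: mrel_zero)
qed

lemma row_q2:
  fixes m :: nat defines "n \<equiv> of_nat m :: rat"
  shows "2 * (n + 3) * (2 * n + 5) * (n + 2) * (n + 1) * ((n + 3)^4 * seq_q (m + 2)) =
     (- 148224 - 2354240 * n - 5405952 * n^2 - 4989888 * n^3 - 2233856 * n^4 - 484864 * n^5 - 40960 * n^6) *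
       seq_a m + (- 1402368 - 4413536 * n - 5562880 * n^2 - 3618080 * n^3 - 1286272 * n^4 - 237824 * n^5 - 17920
       * n^6) * seq_b m + (1646208 + 4890912 * n + 5787840 * n^2 + 3534432 * n^3 + 1183552 * n^4 + 207104 * n^5 +
       14848 * n^6) * seq_c m + (3238400 + 8710240 * n + 9182464 * n^2 + 4924192 * n^3 + 1431424 * n^4 + 215808 *
       n^5 + 13312 * n^6) * seq_q m + (188928 + 653448 * n + 938124 * n^2 + 729884 * n^3 + 333908 * n^4 + 90108 *
       n^5 + 13312 * n^6 + 832 * n^7) * seq_q (m + 1) + (- 1591296 - 4700960 * n - 5516352 * n^2 - 3330144 * n^3
       - 1099328 * n^4 - 189184 * n^5 - 13312 * n^6) * seq_r m" (is "?l = ?r")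
proof -
  have "?l - ?r =
     (2574336 + 7827712 * n + 9501312 * n^2 + 5949696 * n^3 + 2039680 * n^4 + 364544 * n^5 + 26624 * n^6) * mrel
       m 1 0 1 4 + (- 2928128 - 7817984 * n - 8043520 * n^2 - 4132608 * n^3 - 1124352 * n^4 - 153600 * n^5 -
       8192 * n^6) * mrel m 1 0 3 2 + (- 491520 - 1835008 * n - 2867200 * n^2 - 2441216 * n^3 - 1226752 * n^4 -
       364544 * n^5 - 59392 * n^6 - 4096 * n^7) * mrel m 0 0 4 1 + (- 245760 - 671744 * n - 761856 * n^2 - 458752
       * n^3 - 154624 * n^4 - 27648 * n^5 - 2048 * n^6) * mrel m 1 0 5 0 + (152064 + 393552 * n + 382848 * n^2 +
       177648 * n^3 + 39744 * n^4 + 3456 * n^5) * mrel m 2 1 0 4 + (3412992 + 10401280 * n + 12657152 * n^2 +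
       7946752 * n^3 + 2731520 * n^4 + 489472 * n^5 + 35840 * n^6) * mrel m 1 1 1 3 + (- 304128 - 787104 * n -
       765696 * n^2 - 355296 * n^3 - 79488 * n^4 - 6912 * n^5) * mrel m 2 1 2 2 + (- 3900672 - 11356032 * n -
       13107072 * n^2 - 7779456 * n^3 - 2526080 * n^4 - 428032 * n^5 - 29696 * n^6) * mrel m 1 1 3 1 + (- 245760
       - 917504 * n - 1433600 * n^2 - 1220608 * n^3 - 613376 * n^4 - 182272 * n^5 - 29696 * n^6 - 2048 * n^7)
       * mrel m 0 1 4 0 + (152064 + 393552 * n + 382848 * n^2 + 177648 * n^3 + 39744 * n^4 + 3456 * n^5) * mrel m 2
       1 4 0 + (1257984 + 3860352 * n + 4733760 * n^2 + 2995584 * n^3 + 1037760 * n^4 + 187392 * n^5 + 13824 *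
       n^6) * mrel m 1 2 1 2 + (- 1218304 - 3723520 * n - 4542656 * n^2 - 2856576 * n^3 - 981952 * n^4 - 175616 *
       n^5 - 12800 * n^6) * mrel m 1 2 3 0 + (- 3456 - 8640 * n - 8064 * n^2 - 3584 * n^3 - 768 * n^4 - 64 * n^5)
       * mrel m 2 3 0 2 + (- 14592 - 26752 * n - 8448 * n^2 + 10368 * n^3 + 8960 * n^4 + 2560 * n^5 + 256 * n^6)
       * mrel m 1 3 1 1 + (8896 + 24096 * n + 25056 * n^2 + 12736 * n^3 + 3200 * n^4 + 320 * n^5) * mrel m 2 3 2 0 +
       (2640 + 6856 * n + 6720 * n^2 + 3160 * n^3 + 720 * n^4 + 64 * n^5) * mrel m 2 4 0 1 + (- 56064 - 167536 *
       n - 199352 * n^2 - 122224 * n^3 - 41000 * n^4 - 7168 * n^5 - 512 * n^6) * mrel m 1 4 1 0 + (280 + 692 * n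
       + 612 * n^2 + 232 * n^3 + 32 * n^4) * mrel m 3 4 1 0 + (264 + 712 * n + 730 * n^2 + 360 * n^3 + 86 * n^4 +
       8 * n^5) * mrel m 2 5 0 0 + (10 + 19 * n + 11 * n^2 + 2 * n^3) * mrel m 4 5 0 0"
    unfolding exp_q2[of m, folded n_def] exp_q1 by (simp add: seq_mcoef mrel_def n_def[symmetric] numeral_2_eq_2[symmetric]) algebra
  then show ?thesis by (simp add: mrel_zero)
qed

text \<open>The gauge factors make the row vectors of the certificate as small as possible; \<open>8^m\<close> removes most of
  the powers of 2 from them.\<close>

definition state :: "nat \<Rightarrow> nat \<Rightarrow> rat" where
  "state k m = [fact m * seq_r m, fact (m + 1) * seq_q m, (of_nat m + 2) ^ 4 * fact (m + 2) * seq_q (m + 1),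
      fact (m + 2) * seq_a m, fact (m + 2) * seq_b m, fact (m + 2) * seq_c m] ! k / 8 ^ m"

text \<open>\<open>state\<close> with the column denominators divided out. The factorials and
  (m+2)^4 in \<open>state\<close> supply every polynomial factor of these denominators except 2 m +
  5, which is why that one stays as an explicit division.\<close>

definition reduced :: "nat \<Rightarrow> nat \<Rightarrow> rat" where
  "reduced k m = [seq_r m / 2, seq_q m / 6, (of_nat m + 1) * (of_nat m + 2) * seq_q (m + 1) / 8,
      (of_nat m + 1) * seq_a m, (of_nat m + 1) * seq_b m / 2, (of_nat m + 1) * seq_c m / 6] ! k
      * (fact m / (8 ^ m * (2 * of_nat m + 5)))"

text \<open>Polynomials are integer coefficient lists, constant term first.  Entry k is the common denominator of
  column k of A together with the six numerators, so that A is applied without division: \<open>state_eq\<close> and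
  \<open>state_Suc\<close> factor it through \<open>reduced\<close>.\<close>

definition columns :: "(int list \<times> int list list) list" where
  "columns =
  [   ([10, 4],
    [[],
     [],
     [- 198912, - 587620, - 689544, - 416268, - 137416, - 23648, - 1664],
     [],
     [- 483, - 921, - 534, - 96],
     [913, 1763, 1042, 192]]),
   ([30, 42, 12],
    [[300, 120],
     [],
     [1214400, 3266340, 3443424, 1846572, 536784, 80928, 4992],
     [360, 624, 312, 48],
     [- 105, 669, 414],
     [- 4325, - 6523, - 2198]]),
   ([640, 1536, 1472, 704, 168, 16],
    [[],
     [5, 2],
     [47232, 92514, 72144, 27998, 5408, 416],
     [],
     [108, 102, 24],
     [- 243, - 215, - 48]]),
   ([10, 9, 2],
    [[],
     [],
     [- 9264, - 137876, - 199996, - 111872, - 27744, - 2560],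
     [90, 66, 12],
     [- 321, - 510, - 192],
     [111, 798, 384]]),
   ([20, 18, 4],
    [[],
     [],
     [- 175296, - 376396, - 318964, - 133296, - 27488, - 2240],
     [],
     [- 429, - 474, - 132],
     [799, 894, 252]]),
   ([60, 54, 12],
    [[],
     [],
     [617328, 1216764, 953676, 371736, 72096, 5568],
     [90, 66, 12],
     [1227, 1230, 300],
     [- 2757, - 2462, - 548]])]"

abbreviation ev :: "int list \<Rightarrow> rat \<Rightarrow> rat" where
  "ev xs x \<equiv> horner_sum of_int x xs"

text \<open>As g_(m+1) = 2 f_m, the left side is 32 times the coefficient of x^(m+1) in x d/dx f_m^5
  = (5/2) x f_m^4 g_m, and 32 * 5/2 = 80.\<close>

lemma seq_r_Suc: "(of_nat m + 1) * seq_r (Suc m) = 80 * seq_q m"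
proof -
  have "of_nat (Suc m) * coeff (pf m ^ 5) (Suc m) = coeff (px * pderiv (pf m ^ 5)) (Suc m)"
    by (rule coeff_px_pderiv[symmetric])
  also have "px * pderiv (pf m ^ 5) = smult (5 / 2) (px * (pf m ^ 4 * pg m))"
    unfolding px_pderiv_power deriv_f by (simp add: mult_ac)
  finally show ?thesis
    by (simp add: seq_r_def seq_q_def shift_g power_mult_distrib coeff_px_mult coeff_numeral_mult algebra_simps)
qed

lemma lessThan_6: "{..<6::nat} = {0, 1, 2, 3, 4, 5}"
  by auto

lemma state_eq: "k < 6 \<Longrightarrow> state k m = ev (fst (columns ! k)) (of_nat m) * reduced k m"
proof -
  define n where "n = (of_nat m :: rat)"
  \<comment> \<open>In terms of G the factorial becomes a polynomial multiple of one unknown, so the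
    division by 2 n + 5 disappears from all six cases.\<close>
  define G where "G = fact m / (8 ^ m * (2 * n + 5))"
  have n: "2 * n + 5 \<noteq> 0" unfolding n_def using of_nat_0_le_iff[of m, where 'a = rat] by linarith
  have F: "fact m = (2 * n + 5) * G * 8 ^ m" using n by (simp add: G_def)
  assume "k < 6"
  then have "k \<in> {0, 1, 2, 3, 4, 5}" by auto
  then show ?thesis
    apply (elim insertE emptyE)
    apply (simp_all add: state_def reduced_def columns_def n_def[symmetric] G_def[symmetric])
    apply (simp_all add: F)
    apply (intro disjI2, simp add: algebra_simps eval_nat_numeral)+
    done
qed

lemma state_Suc:
  assumes "i < 6"
  shows "state i (Suc m) = (\<Sum>k<6. ev (snd (columns ! k) ! i) (of_nat m) * reduced k m)"
proof -
  define n where "n = (of_nat m :: rat)"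
  define G where "G = fact m / (8 ^ m * (2 * n + 5))"
  have n: "2 * n + 5 \<noteq> 0" unfolding n_def using of_nat_0_le_iff[of m, where 'a = rat] by linarith
  have F: "fact m = (2 * n + 5) * G * 8 ^ m" using n by (simp add: G_def)
  note rows = seq_r_Suc[of m, folded n_def] row_a1[of m, folded n_def] row_b1[of m, folded n_def]
    row_c1[of m, folded n_def] row_q2[of m, folded n_def]
  note defs = state_def reduced_def columns_def lessThan_6 n_def[symmetric] G_def[symmetric]
  consider "i = 0" | "i = 1" | "i = 2" | "i = 3" | "i = 4" | "i = 5" using assms by linarith
  then show ?thesis
  proof cases
    case 2
    \<comment> \<open>\<open>seq_q (m + 1)\<close> is entry 2 of the state already, so this row is a
      mere rescaling.\<close>
    then show ?thesis by (simp add: defs; simp add: F; simp add: algebra_simps)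
  next
    case 1
    have "state 0 (Suc m) = (2 * n + 5) * G / 8 * ((n + 1) * seq_r (Suc m))"
      by (simp add: defs; simp add: F; simp add: algebra_simps eval_nat_numeral)
    also have "\<dots> = (\<Sum>k<6. ev (snd (columns ! k) ! 0) n * reduced k m)"
      unfolding rows(1) by (simp add: defs)
    finally show ?thesis by (simp add: 1 n_def)
  next
    case 3
    \<comment> \<open>The gauge factor is rearranged to exhibit exactly the left side of
      \<open>row_q2\<close>; the next cases do the same with their rows.\<close>
    have "state 2 (Suc m) = G / 16 * (2 * (n + 3) * (2 * n + 5) * (n + 2) * (n + 1) * ((n + 3)^4 * seq_q (m + 2)))"
      by (simp add: defs; simp add: F; simp add: algebra_simps eval_nat_numeral)
    also have "\<dots> = (\<Sum>k<6. ev (snd (columns ! k) ! 2) n * reduced k m)"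
      unfolding rows(5) by (simp add: defs) algebra
    finally show ?thesis by (simp add: 3 n_def)
  next
    case 4
    have "state 3 (Suc m) = (n + 3) * (n + 1) * (2 * n + 5) * G / 8 * ((n + 2) * seq_a (m + 1))"
      by (simp add: defs; simp add: F; simp add: algebra_simps eval_nat_numeral)
    also have "\<dots> = (\<Sum>k<6. ev (snd (columns ! k) ! 3) n * reduced k m)"
      unfolding rows(2) by (simp add: defs) algebra
    finally show ?thesis by (simp add: 4 n_def)
  next
    case 5
    have "state 4 (Suc m) = G / 8 * ((2 * n + 5) * (n + 2) * (n + 1) * ((n + 3) * seq_b (m + 1)))"
      by (simp add: defs; simp add: F; simp add: algebra_simps eval_nat_numeral)
    also have "\<dots> = (\<Sum>k<6. ev (snd (columns ! k) ! 4) n * reduced k m)"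
      unfolding rows(3) by (simp add: defs) algebra
    finally show ?thesis by (simp add: 5 n_def)
  next
    case 6
    have "state 5 (Suc m) = (n + 1) * G / 48 * (6 * (2 * n + 5) * (n + 2) * ((n + 3) * seq_c (m + 1)))"
      by (simp add: defs; simp add: F; simp add: algebra_simps eval_nat_numeral)
    also have "\<dots> = (\<Sum>k<6. ev (snd (columns ! k) ! 5) n * reduced k m)"
      unfolding rows(4) by (simp add: defs) algebra
    finally show ?thesis by (simp add: 6 n_def)
  qed
qed

section \<open>The certificate\<close>

text \<open>Polynomial arithmetic on plain integer lists lets the certificate be checked by
  evaluation; the \<open>ev\<close> lemmas carry the outcome over to the rationals.\<close>

fun list_add :: "int list \<Rightarrow> int list \<Rightarrow> int list" where
  "list_add [] ys = ys"
| "list_add xs [] = xs"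
| "list_add (x # xs) (y # ys) = (x + y) # list_add xs ys"

fun list_mult :: "int list \<Rightarrow> int list \<Rightarrow> int list" where
  "list_mult [] ys = []"
| "list_mult (x # xs) ys = list_add (map ((*) x) ys) (0 # list_mult xs ys)"

text \<open>Substitution of t + 1 for t by Horner's scheme: multiplying the shifted tail by t + 1
  adds it to its own displacement by one place.\<close>

fun list_shift :: "int list \<Rightarrow> int list" where
  "list_shift [] = []"
| "list_shift (x # xs) = (let ys = list_shift xs in list_add (x # ys) ys)"

fun list_dot :: "int list list \<Rightarrow> int list list \<Rightarrow> int list" where
  "list_dot (x # xs) (y # ys) = list_add (list_mult x y) (list_dot xs ys)"
| "list_dot _ _ = []"

lemma ev_list_add: "ev (list_add xs ys) t = ev xs t + ev ys t"
  by (induction xs ys rule: list_add.induct) (simp_all add: algebra_simps)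

lemma ev_map_times: "ev (map ((*) c) xs) t = of_int c * ev xs t"
  by (induction xs) (simp_all add: algebra_simps)

lemma ev_map_uminus: "ev (map uminus xs) t = - ev xs t"
  by (induction xs) (simp_all add: algebra_simps)

lemma ev_list_mult: "ev (list_mult xs ys) t = ev xs t * ev ys t"
  by (induction xs) (simp_all add: ev_list_add ev_map_times algebra_simps)

lemma ev_list_shift: "ev (list_shift xs) t = ev xs (t + 1)"
  by (induction xs) (simp_all add: ev_list_add Let_def algebra_simps)

lemma ev_list_dot:
  "length xs = length ys \<Longrightarrow> ev (list_dot xs ys) t = (\<Sum>i<length xs. ev (xs ! i) t * ev (ys ! i) t)"
  by (induction xs ys rule: list_induct2) (simp_all add: ev_list_add ev_list_mult sum.lessThan_Suc_shift del: sum.lessThan_Suc)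

text \<open>Lists are not normalised and cancellation leaves zeros behind, so equality is tested
  through a difference all of whose entries are 0.\<close>

lemma ev_all_zero: "list_all ((=) 0) xs \<Longrightarrow> ev xs t = 0"
  by (induction xs) auto

text \<open>One column of P_j(m+1) A(m) = t, multiplied by its common denominator d;
  \<open>ss\<close> is the row already shifted to m + 1.\<close>

definition check_column :: "int list list \<Rightarrow> int list \<Rightarrow> int list \<times> int list list \<Rightarrow> bool" where
  "check_column ss t c = (case c of (d, b) \<Rightarrow>
     list_all ((=) 0) (list_add (list_dot b ss) (list_mult d (map uminus t))))"

text \<open>Moving p_(j+1) to the side of P_(j+1), where it affects entry 0 alone, gives all six
  columns the same test. \<open>list_all2\<close> also forces the new row to have six
  entries.\<close>

definition check_step :: "int list list \<Rightarrow> int list list \<Rightarrow> int list \<Rightarrow> bool" where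
  "check_step P P' p = (let ss = map list_shift P in
     list_all2 (check_column ss) (list_add (hd P') (map uminus p) # tl P') columns)"

fun check_chain :: "int list list list \<Rightarrow> int list list \<Rightarrow> bool" where
  "check_chain (P # P' # Ps) (p # ps) = (check_step P P' p \<and> check_chain (P' # Ps) ps)"
| "check_chain [P] [] = True"
| "check_chain _ _ = False"

text \<open>Entry j is \<open>128 p_j / 8^j\<close>, where \<open>L = \<Sum> z^j p_j(\<theta>)\<close> is the annihilating operator.\<close>

definition ode_coeffs :: "int list list" where
  "ode_coeffs = [
   [0, 0, 0, 0, 0, 377913600, - 1574640000, 2204496000, - 1259712000, 251942400],
   [0, 0, - 94478400, - 803066400, - 2188749600, - 591248836512, 2365717930848, - 3009752479296,
    1468407647232, - 230037967872],
   [0, - 7558272000, 307863535104, 3477827166336, 14235692483520, - 575851081776768, 1117571331276864, -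
    901079728791552, 353009020603392, - 62757889606656],
   [- 6660953948160, - 67276026226944, - 291400899812352, - 920514091176000, - 2211101706945600,
    60232767524259264, - 87222240167076288, 65727151270911360, - 15213895909447680, - 146899931996160],
   [4489394277335040, 36153880318319616, 139147667641886976, 356583332717103744, 646054275323531520, -
    9041611177885631616, 19497743509977149184, - 13306032934010383104, 4307020102211880960, -
    356034594397501440],
   [- 873402660712857600, - 2913988875148108800, - 266016142186260480, 15083566323405323904,
    48789932478545508480, - 501513614835802883712, 338075445187322513280, - 187029099765081022464,
    114050723610941061120, - 29347320669584237568],
   [- 176882995148204851200, - 1074492721253521152000, - 2940741944141572880640, - 4892284907231652926208, -
    5918946645147008376384, 13463748247221879931008, - 23203131526391348604096, 9553713573108838262400, -
    712669438037125463040, 146307650110814039040],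
   [9092193573307206758400, 41489533997987836412160, 86446946963992498163712, 126373514735076137437248,
    175907298357464519995200, - 110768001365681599656384, 492776053932491408532672, -
    49709776784362449757056, 1863145910307344726016, 11936796220005132460032],
   [- 315448048113414857441280, - 1888151299061410531049472, - 4883611990081566590009856, -
    7158033924588283467144960, - 6811512805380455064034560, 747705452780136163389952, -
    3669856277025621920867584, 571759830964061865734400, 277439137224723458375680, -
    191240165620284383825920],
   [- 5469638335080901688033280, - 27493309499814218409311232, - 61020967675499780601818112, -
    83627918494095339155812608, - 88687109868164969741854720, - 35727834843379729618340608, -
    79786406411991040656851968, - 6163405794695765818765312, - 11141847203583003301642240,
    1398109040781164709724160],
   [51373550142275542330982400, 358790252121900968403409920, 1084812158946195857368719360,
    1873592014634724265476120832, 2094101989846990032863892480, 1407051230298970614734125824,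
    878885584755365876996029440, 501023273464272233452935168, 22452190669088692616724480,
    8563976167289190860128256],
   [228959455686446058165043200, - 359443592148666411617817600, - 4843188695285554367400000000, -
    12448289809338621102579149824, - 16482308265859572156742948352, - 13887165017180436486987591680, -
    7708164173534707512360538112, - 2327617981856578895907172352, - 573604963358587253411741696, -
    128462640546076453468831744],
   [- 7262860013044127287293542400, - 26154509230351471809916200960, - 28628806272858079482733526016,
    11580168813800199113971311616, 61058008425270674053586529280, 69422080584994640876659684352,
    37811018741023812614869745664, 10564534950827508941196279808, 367872671487899965054779392, -
    200938247850206524657893376],
   [62525022595943802332975677440, 255996728670882138393529737216, 460264406938868125005062135808,
    526620501378727425219016335360, 491385529526598019797888040960, 394265080857325916989221494784,
    240423591467912601955847094272, 90914497040014461142941859840, 18472572890709907240845312000,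
    1407508520276182270304583680],
   [- 471269779551588316522911989760, - 2276891380882250588049704976384, - 4797621922483704220613982142464,
    - 5789374674786245530636043022336, - 4398128703176873283966675763200, - 2170066884340688066082761035776,
    - 672007092729388953589618262016, - 130193412859981972026563395584, - 10443594303828415651743006720, -
    796972017141318468037509120],
   [- 3010893490924456906330221772800, - 13609926346683094497064635678720, -
    26296786005212306000901732065280, - 28452174991590750920890966081536, -
    18949828435878214428412013813760, - 8029425928285290105820438413312, - 2114593717298964458429615800320,
    - 326138381844078202981945442304, - 29362923682214007019929600000, 160650982253121831894515712],
   [- 678559727396288137818783744000, - 3401154807825114934556508979200, - 7384864143226775799032854364160,
    - 9079792623603266196587294343168, - 6918924753635914303531782488064, - 3349729877229696108112818978816,
    - 1014733750244207497749642608640, - 154985038826717942139203223552, 3093646260792617783110139904,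
    6229617350357273846036299776],
   [- 2218578699666066556044902400000, - 10149626460088635433707110400000, -
    19915561966414778367597084672000, - 22118311711521206756349478502400, -
    15634625680058051435096191795200, - 7715057813838176397813492940800, - 2968656986311908460700073984000,
    - 953237169347034322387442073600, - 216872979196604569852103884800, - 22017776332869596711957299200],
   [- 1472643683118663405178060800000, - 6790180969878675977356738560000, -
    12988330860082668550838747136000, - 13027886226445573294537383936000, - 6868565825437923347166953472000,
    - 1290241668361403669856804864000, 458312683744948351990136832000, 282302884197060678816694272000,
    40676538848132832735264768000, - 664791477892303678341120000],
   [10910703815048205854893670400000, 54236561988251739991872798720000, 116772024718701589160424259584000,
    142839638712734580598834888704000, 109381318851428311269090115584000, 54409596520143792473347129344000,
    17617963586826993653027045376000, 3599703199745559102766841856000, 426803607982705034265624576000,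
    23269541840232531829456896000],
   [3580796336229334844375040000000, 17764143550147429225537536000000, 38168083208899085251453747200000,
    46573942045682385038106132480000, 35529489064230219959095296000000, 17544977152981067147943444480000,
    5591899610294454327273062400000, 1101153380832798061292421120000, 118809030321411009911193600000,
    4867944689264671976325120000],
   [- 482996841509736190771200000000, - 2496366192692650388520960000000, - 5610633815925271633231872000000,
    - 7186384622876564263993344000000, - 5767962692613110271442944000000, - 2997735115067258502316032000000,
    - 1002846052808824808079360000000, - 206016141126835856867328000000, - 23084768131513589956608000000, -
    1022160822863312977920000000],
   [220200675016524329779200000000, 1143961408221719144693760000000, 2591870301323576160878592000000,
    3361567117051928255053824000000, 2750705615363445317173248000000, 1473006769928507768979456000000,
    516360891483422694309888000000, 114300912403426952871936000000, 14502185727087080374272000000,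
    803461308473460916224000000],
   [- 183861861962711040000000000, - 1826939591760863232000000000, - 6252656619969515520000000000, -
    10984454302390027223040000000, - 11392215318818403287040000000, - 7369464883796172472320000000, -
    2999441453984863027200000000, - 743086196261323407360000000, - 101565858837965045760000000, -
    5796139365071585280000000],
   [75547407753216000000000000, 424684356441292800000000000, 1048064391099555840000000000,
    1490203796227448832000000000, 1345138383358844928000000000, 799182449995603968000000000,
    312430501841633280000000000, 77470868737916928000000000, 11051506505613312000000000,
    690719156600832000000000]]"

text \<open>Entry j is the row vector \<open>P_j\<close>, scaled like \<open>p_j\<close>.\<close>

definition cert_rows :: "int list list list" where
  "cert_rows = (hd ode_coeffs # replicate 5 []) # [   [
    [0, 0, - 94478400, - 803066400, - 2188749600, - 591248836512, 2365717930848, - 3009752479296,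
     1468407647232, - 230037967872],
    [0, 629856000, 1889568000, - 1259712000, - 8817984000, - 6928416000, 4408992000, 7558272000, 2519424000],
    [],
    [],
    [],
    []],
   [
    [0, - 7558272000, 307863535104, 3477827166336, 14235692483520, - 575851081776768, 1117571331276864, -
     901079728791552, 353009020603392, - 62757889606656],
    [0, - 1646376399360, - 6484727237760, - 3929129208000, 13826635303680, 22616374461120, 8280379509120, -
     3718960957440, - 2300379678720],
    [0, 236196000, 866052000, 944784000, 314928000],
    [],
    [],
    []],
   [
    [- 53643172700160, - 307864327042944, - 825460998524352, - 1595565565920000, - 2747153095401600,
     59955087790923264, - 87316194526884288, 65707102324575360, - 15216347308999680, - 147030942044160],
    [- 415333093017600, - 661841229352320, - 331352048306880, - 2394361543639680, - 5117022764297280, -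
     3797455451339520, - 1850460985589760, - 1487958552898560, - 627447886018560],
    [382467458880, 1104418903680, 614227872960, - 387082903680, - 279359331840],
    [- 2188119744000, - 36212625936000, - 102973267872000, - 126864650736000, - 82084723488000, -
     29142177408000, - 5376450816000, - 403107840000],
    [- 20702107008000, - 78955126488000, - 125556439824000, - 108158085000000, - 54595603152000, -
     16169663232000, - 2605084416000, - 176359680000],
    [24301734048000, 88402021704000, 133575451488000, 109137196152000, 52256003040000, 14705248032000,
     2257403904000, 146126592000]],
   [
    [34388730820823040, 187541496552370176, 483825005405248896, 814732510747253184, 1033524508833158400, -
     8827043490489594816, 19575227645038030464, - 13288463816306022144, 4309290118889902080, -
     355907134206720000],
    [168166809996134400, 682244814394045440, 1150378591059757440, 1093299685979296320, 476259368841449280, -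
     281380170848071680, - 466243520515372800, - 166099561063004160, - 1588135333847040],
    [- 254410566318720, - 555676452201600, - 562746819548160, - 254578191528960, - 86397247676160],
    [12980867746176000, 52443538778488320, 96683708314085760, 105393094149398400, 68725325339239680,
     25701650694696960, 5039593883873280, 400148132659200],
    [13123796349312000, 49319541819786240, 82782710441150400, 77423889566128320, 42658892138263680,
     13717751209562880, 2377609900462080, 171467070566400],
    [- 13656992548032000, - 50834813538781440, - 84000918144415680, - 76197909641376960, -
     40279576517769600, - 12367170169977600, - 2045764942479360, - 141107944181760]],
   [
    [- 5904348209640345600, - 16217891282705840640, - 6498146498024862720, 32262643027188831744,
     79799306763409326720, - 477337142836852987392, 348813557797312828800, - 184214697583494680064,
     114457413961633996800, - 29322267805565273088],
    [14017136400483840000, 72486785710001134080, 154889927073095443200, 153968374830455982720,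
     92703944732681934720, 81113150753995703040, 64000326617641105920, 13981718445393070080, -
     3593412004569845760],
    [47911116146054400, - 21794353898290560, - 59815205278058880, - 31671498251347200, - 1764320917916160],
    [- 7247313593144985600, - 22636573188614346240, - 24573273150437533440, - 9952543457387930880,
     1082913668471462400, 2246403645297285120, 688565637812367360, 69435801764167680],
    [- 2185596246483302400, - 2855682550366030080, 1991650102411731840, 6250196041681392000,
     5137440649815444480, 2063107219712025600, 416523117928919040, 33834244886507520],
    [1520372660663116800, 76027763870830080, - 5878578633242739840, - 8730744665899075200, -
     5825221173427380480, - 2071543106806295040, - 382697954464849920, - 28957568573952000]],
   [
    [- 1312266670968861388800, - 5932406674437451476480, - 11961282675398767752960, -
     14527483559186917350528, - 12526430506231953006144, 10404343516588452119808, - 24171281345506806115776,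
     9350512485852053934720, - 738297801455251553280, 144839622443841285120],
    [- 1847232527441191833600, - 7473138198021858470400, - 9002444671092220093440, - 2090310642926107643520,
     1780855156267002357120, - 793533471985833753600, - 2188222782182418908160, - 1214645149741932564480, -
     293678892350449182720],
    [9999999374854118400, 12562608793299264000, 7345477373302310400, 2522090539482508800, -
     357424771385433600],
    [- 1065707454753689241600, - 3814234303734516441600, - 5481558226909326539520, - 4181261256113868875520,
     - 1886083429043803691520, - 522107880118096343040, - 84316556114607144960, - 6132995089785815040],
    [- 496133345486764800000, - 1470739562978883206400, - 1847602267554584027520, - 1302107774516811527040,
     - 571017620196645753600, - 159367011094812787200, - 26322308360145838080, - 1952837187380674560],
    [420413736427973913600, 1159067913762891744000, 1368657325250042129280, 928855448124024101760,
     403963377293628921600, 114020383328730201600, 19077144414423736320, 1419042649557565440]],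
   [
    [58033716552234532224000, 209017073231420730497280, 361345299687211227432192, 447116553469765739700288,
     471910610171415638445120, 89983491666989793961536, 583758942124775263756992, - 24187281944194628378496,
     5845306887460267370496, 12200467064577372168192],
    [- 34890260604428551910400, - 24812340214925116442880, 22583467508862274139520,
     130674918262370983113600, 282838967167137696167040, 242895835896372530616960, 71883353362888645320960,
     1858684211716188026880, 1275175539182929213440],
    [- 481621957523826523200, - 140834459296727654400, - 431478910818327211200, - 249741351457703193600, -
     53189289329571129600],
    [54522241339590710092800, 170537499924807014208000, 204555064205798741030400, 151513308779905553587200,
     88869488659619903078400, 37860796361580586905600, 9104631810294975897600, 880634295538237440000],
    [21310906955736041740800, 44823325518162332755200, 53555439698873813203200, 54516050685382678848000,
     40246998010322214643200, 17532651828811153075200, 3947445189001029427200, 354001186081531699200],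
    [- 18611740612925769715200, - 31979596176193797446400, - 38229925607333199072000, -
     45537615670707468057600, - 35790333356337120691200, - 15394421339662191667200, -
     3332229045307464499200, - 285601966360272691200]],
   [
    [- 2008850700792306790932480, - 10478912145693452718953472, - 23695432935411538195289856, -
     30239866770332272214751360, - 24083315278001520519144960, - 7302663374139301259781248, -
     5951991561178662569008384, 210910469111047429113600, 252710432369062045050880, -
     191318344110432643870720],
    [2282205199202373786624000, 8538241649724805295370240, 14377696251532595753794560,
     12438171140955647652552960, 4825536865513847459775360, 808313324221301223565440,
     948806341103925237669120, 696995792569388285061120, 103400463466825081528320],
    [16983215221938714339840, 31088781989415566216640, 19680351409147026761280, 1905132521815681397760,
     164283098032132404480],
    [- 1966905518579473230950400, - 9707046347610217513267200, - 17947982517193337782982400, -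
     16800109572628986601132800, - 8623822532678245215014400, - 2396578285027060737177600, -
     324649587061819368345600, - 15453595289918929305600],
    [- 732693906845133966028800, - 2755162221128203067481600, - 4280207491561172797814400, -
     3451266646788517816924800, - 1508888834177135149612800, - 337076319216019075200000, -
     29685756600209326694400, 111039003172106956800],
    [640277632605969151948800, 1994350905574339739904000, 2624847718400990611171200,
     1775737701153134165520000, 608351243564673671616000, 78427307508295515840000, - 6481269647476493414400,
     - 1906676504225354649600]],
   [
    [- 57573990990019355503380480, - 242577623905890912364580352, - 450376106124241319650397952, -
     501263546195929550101509888, - 392305883567569478161377280, - 195369080352261694970699008, -
     140484707054849889521897728, - 21816535962802565064504832, - 13542126719599637322618880,
     1235581863720850039316480],
    [31894526592442640871168000, 85258081447153193269726720, 77057205190372427442008320,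
     10250211144950141904476160, - 30578778867571446795951360, - 33589604413971903728394240, -
     26537590647997827222028800, - 12407403713093269284014080, - 1906656053482635075665920],
    [366041437791344110419840, 384943419980486459424000, 211380702796974320277120, 145062718357657718142720,
     23083006499622802091520],
    [- 78759471943648346142182400, - 242331793434125452607523840, - 313916255245790716028958720, -
     229920004338398831849702400, - 109925754020637523913640960, - 36196304346606411182315520, -
     7427537769851944035471360, - 679745570336433414144000],
    [- 22930332490348171984972800, - 64335831051847992969934080, - 78520663946118482593574400, -
     58045492719100823275779840, - 30035615880289336349276160, - 10810239038900032303618560, -
     2327281002176163317084160, - 215783441768871019008000],
    [9478122019915656549772800, 22751276681165679558074880, 25382834730824561177736960,
     21278015603901045469854720, 14522126262872163830150400, 6516110639909016208281600,
     1565623179743789731921920, 150621297635917709291520]],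
   [
    [- 248902772289652766483251200, 56017039780506561758438400, 2490750005995820088298333440,
     5650485927676971848641812352, 6374904379863340729373145600, 4222552377767645696205485184,
     2038685701887879780234835200, 798530147748477349584749568, 66122975541395413709291520,
     11370070352423059692240896],
    [- 326033385884350325670297600, - 1671093402165120837070863360, - 2830855123826573270052972800, -
     2329049382138344594896371840, - 844007978505878917975059840, 122089147674068323165029120,
     233145550126622770814991360, 92311130272964870858096640, 19239367059705852406661120],
    [521790034280161859136000, - 7209396487445106277572480, - 5948232973298322263533440, -
     2751264164692406774144000, - 413712893256196186465280],
    [- 513659157011392591703808000, 13331481266099438344442880, 2561309385211145162770778880,
     3919331806067088572473532160, 2686912119053172149555059200, 992983464485245413506396160,
     194919915521210863255879680, 16009777814372030846730240],
    [- 116102745596343793495449600, 81123482508223863742479360, 646473532526464583711387520,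
     863485795433404152319536000, 567792580798746681074922240, 211009108157754820654809600,
     42795418464698031088312320, 3683511689646790141378560],
    [- 32380498343652637481395200, - 346304443312228302824348160, - 678100993176535327263784320, -
     636895412527967280146582400, - 358309743597827882810423040, - 126295030058982884712414720, -
     25610441339072845904732160, - 2242189190773470776524800]],
   [
    [2003101257815673056156467200, 4109852776689765859565608960, - 6228302057514698293361768960, -
     29279973862287520374711113984, - 42103023587087434131170988032, - 33599306711016067428493940480, -
     16625580159958641857579351552, - 4744075760595090754895419392, - 939414050405555754334396416, -
     152387438660148400565551104],
    [3442530383898161763298304000, 16133852411985852397272217600, 30474411057845178126017953280,
     29921666713657455068302391040, 14671514325854383260512943360, 1353156670693716975938188800, -
     1709124830363706644787783680, - 491976294758771849874595840, 5635251187141106739773440],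
    [850681120898734240377600, 38641147615194407328480000, 56223527916144940536537600,
     21843377154836170878643200, 3900220764592728244377600],
    [5151617424808170725492428800, 8869566463755280957172172800, - 6544428865722252232548098560, -
     24524772866236191685565084160, - 21718924871859962674491765760, - 9068403254944428017331486720, -
     1885931532188648060343009280, - 158506276580434938909163520],
    [1015161526842216275924275200, 1584795441480157671685644800, - 1381107031567665948716424960, -
     4519426345951715075596773120, - 3909161981108643749377075200, - 1644356825642391119952153600, -
     352463220427728447485706240, - 31134584553602869165998080],
    [647674164824154609642393600, 3388352653099128917655206400, 6461311214320763123612701440,
     6233203963295694178385268480, 3460113427896169292285337600, 1154205007890121001886489600,
     220020020651613975291740160, 18528093963321919322603520]],
   [
    [- 6481444033687366959451545600, - 30680836718748691546236057600, - 18916095167792649353521714176,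
     83421924429765795254139559936, 178629538330255806279329904640, 160488096509309845636826227712,
     75576488344035730636652058624, 18789160200878844567655026688, 1156902082458922088756805632, -
     186851546394860486850052096],
    [- 36766160016642643806635827200, - 124905372022399774262416988160, - 197521417836354843231456680960, -
     166081779950962308827013555200, - 76020013063066201071762488320, - 23846634388404024604026183680, -
     9956729905916058811508346880, - 3735805515026689421381795840, - 535407654852648811631083520],
    [- 57314768976649045884556800, - 85225283341050774528921600, - 355397881739985231568588800, -
     112639497839430928015462400, - 176012442566489020518400],
    [- 25331848694130869115850137600, - 68463240521122929247861401600, - 23438953397047501222001817600,
     86327053761629911150299494400, 105661632665517162324439142400, 47982251221886292045262848000,
     9286992689691157252413849600, 602993919942382163617382400],
    [- 4157758320470068213878681600, - 15781903113532656163302297600, - 8523594235692205173356390400,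
     12883209652154148987083750400, 16049401913058645230622873600, 6287494093488744398214451200,
     867256383563026895708160000, 10587581786247782950502400],
    [- 5821228835478580129607577600, - 19380542023844625646994688000, - 37912149493540583192005939200, -
     39745450559298028457159040000, - 21221883464884855016964864000, - 5297885346812738664903782400, -
     403985519449401652607385600, 26715253358818254933196800]],
   [
    [- 4372015432387953107284623360, 55417891931372400749801865216, 451767406419793992172250411008,
     1202066898339214938319306127360, 1656975556340892931057187010560, 1353881591681796676566204227584,
     690193075367681908715763535872, 213270354297595239340535767040, 36448480401541879604357529600,
     2508959894737171148821626880],
    [166019655231066627604306329600, 556441961160842248534510510080, 657183383696619813858756280320,
     370802415206071635889754142720, 138729286429256325948885073920, 62495244191749281285380014080,
     25604783030937099586720112640, 5278882732270137918700093440, 470239039713264353433354240],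
    [486564515325430887886433280, 221409457163296779264583680, - 1676110492505631424338186240, -
     979072629536531517204910080, - 135766667760392906361200640],
    [74074098830303480258492006400, 264415232760006638927101747200, 577298999075034427144726630400,
     884445285211501017349720268800, 789987821759337423190685286400, 377399516884023277281487257600,
     88593240331765552184588697600, 7956180239552716711893401600],
    [5599024529012917652540620800, 57860708731750687135890585600, 202678671702029337699572326400,
     302341240281549151496379084800, 227821625915203129119315660800, 90951084257452665049711616000,
     18218252019261374395778662400, 1432237730496607074915123200],
    [33456814752203490877251379200, 92829685457447905218428160000, 52272570462831438401683660800, -
     45437957927667848216205312000, - 64962755665971074823877632000, - 29250994278864706703861760000, -
     5824469083783173980395929600, - 433982878804974476756582400]],
   [
    [139056935700725729481607741440, 714681817572319496706956722176, 1551136853026244150626785939456,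
     1910410052056571381277764757504, 1517293039094329906958344212480, 826145202898772800307318605824,
     327946255310498773196380606464, 80597441822516259315057278976, 14730741915930448158100684800,
     477078056624785895943045120],
    [1151720804849398658964961689600, 4283420897944656398547617955840, 6597028509815441018279735562240,
     5540824433562666264649623275520, 2788817155414654046706694318080, 860982941641506608438371921920,
     158253641427261906593915289600, 15581077349358871393572618240, 435386117259129289530408960],
    [2412245929296104345271674880, 3896134531256392369457817600, 1430375719348254198502103040, -
     53717444382574362925301760, - 20848249646223478569615360],
    [758023753425428534042920550400, 2180357896815080130344829419520, 2258318841046697572088829480960,
     1047791816701435168841356800000, 217671522547612745747365601280, 24340591982507922312697282560,
     5454722100548580889315246080, 698881312389841684581580800],
    [108124402719100534265150668800, 459557387555466864883649187840, 796083185516352695259845376000,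
     746447644065935987938794731520, 410361482622401014481993748480, 130774972003989424559383879680,
     21883416848489074839947182080, 1424567474718602054408601600],
    [210879704140809910438193971200, 728313492129454696385117122560, 1018876365335297641868542494720,
     753236933829550798205434890240, 318569397584584946075916595200, 77259938031352456710607872000,
     10109522630501890025507389440, 584941126572752805058314240]],
   [
    [11130692129433322626657484800, 47402990192624185763521904640, 332531695851562647124896890880,
     975463206227156713496933167104, 1388910972233176742506380410880, 1107714062377055493969130795008,
     563230414350200183161504358400, 170456190261784748527661776896, 23994176436380824424233697280,
     2721077517327774253847150592],
    [134580813161779749752060313600, 628810695636309484867547873280, 1104784650442400954491898265600,
     1074550979722504277574796677120, 646408713320847677301920133120, 253327683318363376784798883840,
     69456212393746489526605086720, 9970177710594668287998689280, - 1106566037021741387203215360],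
    [329015596933996769024409600, 915008309713799324171735040, - 997458871885475135288647680, -
     591441844509934260376780800, - 105603393784774615180738560],
    [85240851956535899929942425600, 279166218495808405237877391360, 620443333723323157547518402560,
     873005005920199489172891934720, 647659215968639932028046950400, 259881505201583569215128862720,
     60119681599681538149833768960, 6429266150487844024567726080],
    [10829595615660609617719296000, 48379724441677321984895262720, 193544876546831892397813616640,
     318043476324151042148249088000, 243453207108002175180983009280, 94893256181342960366470348800,
     18785107049406221648870768640, 1515584110254706922174545920],
    [26744916095541862267377254400, 115603181417572647276348334080, 148899235410054001217187164160,
     86952830969480946772691865600, 23494839991926023919206891520, 1178267467320325484949749760, -
     618956888123165853497425920, - 72831102315179109167923200]],
   [
    [109016365683321956163000729600, 500766382097649253607564574720, 1084019954057199651722861445120,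
     1439280065751233096834320269312, 1322859988360416003940962533376, 921746046362963625637586141184,
     488836634911557838817488404480, 205292881959879044132746887168, 58087152658856307156715044864,
     10290717607581950388974125056],
    [749236337873653118399682969600, 3022343123804646724591430860800, 4854727279927095286061203292160,
     4143503037769564558687149588480, 2005925866863001696258216427520, 538220365110910837555207372800,
     107815155855453257299939491840, 40710619304902016723197624320, 8996827960762878721555169280],
    [1526213632848474638223360000, 3242456729228363057436672000, 612899152567309582682112000, -
     24684567494653244915712000, - 392139520704259957334016000],
    [533866078198726051010464972800, 1554290577304755731232517324800, 1636099340415654375267387310080,
     831616601412853091476136263680, 331338477501255351978621665280, 199155948221142170372352245760,
     87269859580591817833961226240, 14268294718472318089754050560],
    [78927600967236572293074124800, 315834388996077708639893913600, 574241076134167406743805460480,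
     571969613715151764605218652160, 346146720461392433203416268800, 138510609956793611670424780800,
     36061132029353353949290168320, 4535265435212172191874416640],
    [139924459827722292049251532800, 523257472408443258897963417600, 737954051134586172392245985280,
     540249821924292018114595061760, 219694521803642578705607884800, 40947686865871219127078092800, -
     1618256559096097534488084480, - 1355152136886725046262824960]],
   [
    [1627043160268399597623705600, 168469220847131483417088491520, 953864350887107189430747463680,
     1320568194983380501342377738240, - 370603661728977082415123988480, - 2479604396949607971905103790080, -
     2563211946734935480265988833280, - 1286650815209544699051959255040, - 327720371167142984152338923520, -
     32781408735552389286608240640],
    [367554198764370998057671065600, 1571086007518280745891210854400, 2863368327775346694487970611200,
     3608030012668824728078268825600, 2959001043731869158839417241600, 1303971761256607294628600217600,
     226910954523974461215739084800, - 7797208502840130733119897600, - 3149685663263366002193203200],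
    [991300007889334546882560000, 1367288334615288396349440000, - 784914129815117975285760000,
     6204850397268606999797760000, 1797330520263034376110080000],
    [175444864581513424861613260800, 782558336229219252344527257600, 1646860677365761041315918643200,
     946111881231903642743498342400, - 1283530617598200535569943756800, - 1842513694312608881900951961600, -
     779825364595683172148654899200, - 108026337250333085376341606400],
    [16674321706363552548932812800, 154156903557615732315547238400, 490928031127062529546892083200,
     370244933188117861997607321600, - 156240535912138894294322380800, - 298682547437048013571630694400, -
     121061758543716222293586739200, - 15440212391479784139364761600],
    [70901434919516216774757580800, 265879251916191263207360102400, 401619294764210711104148275200,
     583477926662922563280509337600, 599579267523475134358639411200, 322303140958591996805814681600,
     81457435878103989256244428800, 7582473909827113129633382400]],
   [
    [- 243204801663047573133066240000, - 1429495050071134737974329344000, - 4009632269256425671247418163200,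
     - 6574900479454201876322011545600, - 6746113790181319273026040627200, -
     4519496662670372327521888665600, - 2046106196988270678418091212800, - 634048318055198613750998630400, -
     130594269081632266163375308800, - 13830442840098354572977766400],
    [- 1938924919323872190545264640000, - 9909193493519637879844601856000, -
     20486118732547798275822379008000, - 22706549288295917692883152896000, -
     14842206559099590578090201088000, - 5875915868867269229720592384000, - 1387118510174384311848763392000,
     - 185355615435373701186453504000, - 12229939927433933909655552000],
    [- 3994127913551479251148800000, - 12905588421782892210032640000, - 9314152986045452168908800000, -
     1508384309836627968491520000, 429142502229957430640640000],
    [- 1285862210220546094372945920000, - 5274589242218037034563698688000, -
     8406798444589777921644945408000, - 6346960957126257588976803840000, - 2215331347010386261480390656000,
     - 279413112187842513320411136000, - 19046118901126088069480448000, - 10645709169817515410325504000],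
    [- 185508447448347454584913920000, - 979752001092184302343077888000, - 2335925745904841045403365376000,
     - 2976642560652898015831191552000, - 2162734648260157938056159232000, - 903659059286613201931223040000,
     - 203457269449589153969995776000, - 19282226109358246855704576000],
    [- 352649210109078677589688320000, - 1729997672753053482775216128000, - 3302995558749935538287333376000,
     - 3286974352459981135111852032000, - 1859261838883408643125911552000, - 596374353474938183329136640000,
     - 99009641718371226607681536000, - 6336594184051237931974656000]],
   [
    [- 79910513789250103710842880000, - 472034653286210274504278016000, - 1340541708127818633862594560000, -
     2163362230313642105931423744000, - 2050896364372232190636982272000, - 1119026839530272070379216896000,
     - 303945981012546218247536640000, - 7080400828668651508924416000, 17198227317663061668790272000,
     3363166702708744485076992000],
    [- 668205594380547444485652480000, - 3296654914859639054342553600000, - 6684516005034138005561425920000,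
     - 7437977509462921903118376960000, - 4998674946267024533130977280000, -
     2067254996611152692061388800000, - 504569456467056618324295680000, - 63064123871576941890109440000, -
     2363984152591316224573440000],
    [- 1396203030316449941299200000, - 4162669091840860027084800000, - 2831864759422735892889600000, -
     1098099084958801470259200000, - 284594044834005029683200000],
    [- 436958632467253725075210240000, - 1736880527630039441481400320000, - 2754199129788203727721512960000,
     - 2076212807802407858691686400000, - 591532371217421275457617920000, 135687820961471021383680000000,
     123929867110667133132472320000, 21290965287303411526533120000],
    [- 62294505379688250916208640000, - 325983281020007977139650560000, - 774772772391382300642713600000, -
     963687381859124868765818880000, - 660455164578396225246658560000, - 247496063373678292150026240000, -
     46244633754826949787648000000, - 3211773235182004634910720000],
    [- 121820275130517280256163840000, - 573802051559065603063234560000, - 1071684486742019672993587200000,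
     - 1084337163854752445509754880000, - 656503370183130481463132160000, - 239228592614731598736752640000,
     - 48448015514819055098265600000, - 4208106464066906758840320000]],
   [
    [7351413195163611974860800000, 48430263422355640751554560000, 151897650435522225403822080000,
     273410702691276642104770560000, 286010762398865827504128000000, 160845570589652912620339200000,
     30515068014403638453534720000, - 14685434737823996052111360000, - 9428101727565505521254400000, -
     1647485290632648861941760000],
    [63147509343997978234060800000, 348231765389130245342822400000, 801912575611214801591500800000,
     1016928947824842597691392000000, 781532364230351945404416000000, 368543003668797087734169600000,
     100286617938131001832243200000, 13065327687080052523008000000, 404405525354998608691200000],
    [132835882298832046080000000, 469690445218994380800000000, 467403386210898370560000000,
     195178491010718023680000000, 111716354669668024320000000],
    [40949310234814982907494400000, 187624154581486101120614400000, 350161408532559036653568000000,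
     321934965843904271120793600000, 118808662450020632484249600000, - 26952545532744355833446400000, -
     34771202436203159224320000000, - 7600041412026745592217600000],
    [5801080714363118724710400000, 34095391003899819609292800000, 90538182359514175699353600000,
     129034686819692445423206400000, 100119573032963901913497600000, 40355555690562485973811200000,
     7105225060470307317350400000, 250474631833843767705600000],
    [11517306605488321767014400000, 60903977687779050351820800000, 130680389636666590976409600000,
     152005253878781323540070400000, 107140419733368718997913600000, 46211820667342215738163200000,
     11114022720062056719974400000, 1115192797163703867801600000]],
   [
    [- 3438261217310640832512000000, - 22265294733479647405670400000, - 68498313148433862416793600000, -
     121660696877318037105868800000, - 131659103161676156549529600000, - 87790346280548095426560000000, -
     35041254822723650627174400000, - 7552035931514210530099200000, - 609681140599524714086400000,
     21698734400324134502400000],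
    [- 28740444587491406118912000000, - 157668531733200178741248000000, - 361546952370000177659904000000, -
     458118746924344792915968000000, - 351163407439837753344000000000, - 165819599081379671703552000000, -
     46549511093804631883776000000, - 6944729377042770296832000000, - 401015011851572871168000000],
    [- 60029349428740608000000000, - 211983865767046471680000000, - 212101702424171642880000000, -
     90454783998443765760000000, - 14690531659602493440000000],
    [- 18792237071399574306816000000, - 85196350295503030812672000000, - 157043662975932427321344000000, -
     143385159336290533933056000000, - 59319976415232799014912000000, - 1459619445049910231040000000,
     6571806518639310667776000000, 1474269950046596235264000000],
    [- 2679600199515170144256000000, - 15527332986463351185408000000, - 40695570644068261822464000000, -
     57667420531075842293760000000, - 46879983145292181258240000000, - 21905180130871164174336000000, -
     5480105859295701368832000000, - 569675244217594281984000000],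
    [- 5238174541495746134016000000, - 27573292106122590609408000000, - 58960545229687023304704000000, -
     68551070991965332439040000000, - 47357839002615172300800000000, - 19505519848259276046336000000, -
     4434712677542906560512000000, - 428924786597164744704000000]],
   [
    [- 23242148658272010240000000, - 102054628692636991488000000, - 189066621124154179584000000, -
     83096395533237067776000000, 212434263909994807296000000, 334774061376755097600000000,
     191764947076306550784000000, 42662384265461170176000000, - 1066436361079750656000000, -
     1461416573546790912000000],
    [- 194821407096251351040000000, - 660712865733597265920000000, - 549349470404238458880000000,
     436186109992781537280000000, 1106293037980157337600000000, 831613577960720056320000000,
     299799758242614804480000000, 50272667749641093120000000, 2805973794989015040000000],
    [- 407200791422361600000000, - 583995852076032000000000, 869576134011494400000000,
     445748006839910400000000, 180793833991372800000000],
    [- 127273893666902507520000000, - 310754215048011448320000000, - 76170720109561528320000000,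
     427139351911404748800000000, 436885650116649123840000000, 86350466922047078400000000, -
     47277975108672552960000000, - 15235357195810897920000000],
    [- 18136286991893790720000000, - 67220345866540400640000000, - 87051210052466073600000000,
     28827776600226570240000000, 146824374994261032960000000, 115297630028535398400000000,
     35638804999860387840000000, 3719232936628715520000000],
    [- 35508988260712120320000000, - 112531018488137072640000000, - 69594339643602739200000000,
     95942663150141399040000000, 172650030296007720960000000, 109139727941332992000000000,
     31901160728588451840000000, 3547409155038904320000000]],
   [
    [- 513242706640896000000000, - 4173014960116531200000000, - 15567242880584908800000000, -
     33915649656910233600000000, - 45813067282405785600000000, - 38511650156097945600000000, -
     19458973656384307200000000, - 5355311905367654400000000, - 595425495180902400000000,
     7674657295564800000000],
    [- 4302604746326016000000000, - 30659056730578944000000000, - 91495105780359168000000000, -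
     149131482278750208000000000, - 144985368591341568000000000, - 85507074342014976000000000, -
     29434709058895872000000000, - 5247546925842432000000000, - 345359578300416000000000],
    [- 8993739018240000000000, - 46467651594240000000000, - 80943651164160000000000, -
     53962434109440000000000, - 11991652024320000000000],
    [- 2810843234500608000000000, - 17363512409481216000000000, - 43566671108689920000000000, -
     55504760420634624000000000, - 35051199145353216000000000, - 6715325133619200000000000,
     3063467370479616000000000, 1227945167290368000000000],
    [- 400521177612288000000000, - 2981324554113024000000000, - 9783689095342080000000000, -
     17825490803718144000000000, - 18910835242352640000000000, - 11522778430169088000000000, -
     3722208788348928000000000, - 492457176465408000000000],
    [- 784254042390528000000000, - 5413631306379264000000000, - 15350813547632640000000000, -
     23294683431143424000000000, - 20637633133854720000000000, - 10743321048588288000000000, -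
     3050676274987008000000000, - 364546221539328000000000]]] @ [replicate 6 []]"

text \<open>By evaluation: 24 steps of six columns, that is 144 identities between integer
  polynomials.\<close>

lemma check_cert_rows: "check_chain cert_rows (tl ode_coeffs)"
  by code_simp

definition const_coeff :: "int list \<Rightarrow> int" where
  "const_coeff xs = (case xs of [] \<Rightarrow> 0 | x # _ \<Rightarrow> x)"

text \<open>This is P_j(0) s(0) = 0 for the initial vector s(0) = (32, 0, 1024, 0, -64, 0), which is
  computed in \<open>val_cert_rows_0\<close>.\<close>

lemma check_cert_rows_0: "list_all (\<lambda>P.
    32 * const_coeff (P ! 0) + 1024 * const_coeff (P ! 2) = 64 * const_coeff (P ! 4)) cert_rows"
  by code_simp

definition val :: "int list list \<Rightarrow> nat \<Rightarrow> rat" where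
  "val P m = (\<Sum>k<6. ev (P ! k) (of_nat m) * state k m)"

text \<open>P(m+1) s(m+1) = P(m+1) A(m) s(m), and the checked identity replaces P(m+1) A(m) by P'(m)
  minus p(m) in entry 0.\<close>

lemma check_step_sound:
  assumes "check_step P P' p" "length P = 6"
  shows "length P' = 6" "val P (Suc m) = val P' m - ev p (of_nat m) * state 0 m"
proof -
  define ts where "ts = list_add (hd P') (map uminus p) # tl P'"
  define x where "x = (of_nat m :: rat)"
  have all: "list_all2 (check_column (map list_shift P)) ts columns"
    using assms(1) by (simp add: check_step_def ts_def)
  have len: "length ts = 6"
    using list_all2_lengthD[OF all] by (simp add: columns_def)
  then show len': "length P' = 6" by (cases P') (simp_all add: ts_def)
  have col: "(\<Sum>i<6. ev (P ! i) (x + 1) * ev (snd (columns ! k) ! i) x) = ev (fst (columns ! k)) x * ev (ts ! k) x"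
    if k: "k < 6" for k
  proof -
    obtain d b where db: "columns ! k = (d, b)" by fastforce
    have "list_all (\<lambda>c. length (snd c) = 6) columns" "length columns = 6"
      by (simp_all add: columns_def)
    then have b: "length b = 6"
      using k db by (auto simp: list_all_length)
    have "check_column (map list_shift P) (ts ! k) (d, b)"
      using list_all2_nthD[OF all, of k] k db len by simp
    then have "ev (list_add (list_dot b (map list_shift P)) (list_mult d (map uminus (ts ! k)))) x = 0"
      unfolding check_column_def prod.case by (rule ev_all_zero)
    then show ?thesis
      using b assms(2) db
      by (simp add: ev_list_add ev_list_dot ev_list_mult ev_map_uminus ev_list_shift mult.commute)
  qed
  have "val P (Suc m) = (\<Sum>i<6. \<Sum>k<6. ev (P ! i) (x + 1) * ev (snd (columns ! k) ! i) x * reduced k m)"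
    unfolding val_def by (intro sum.cong refl) (simp add: state_Suc sum_distrib_left x_def mult.assoc add.commute)
  \<comment> \<open>After exchanging the sums each column is complete, and \<open>col\<close> trades
    its numerators for the denominator that turns \<open>reduced\<close> back into
    \<open>state\<close>.\<close>
  also have "\<dots> = (\<Sum>k<6. (\<Sum>i<6. ev (P ! i) (x + 1) * ev (snd (columns ! k) ! i) x) * reduced k m)"
    by (subst sum.swap) (simp add: sum_distrib_right)
  also have "\<dots> = (\<Sum>k<6. ev (ts ! k) x * state k m)"
    by (intro sum.cong refl) (simp add: col state_eq flip: x_def)
  also have "\<dots> = val P' m - ev p x * state 0 m"
  proof -
    obtain a as where P': "P' = a # as" using len' by (cases P') auto
    have "{..<6::nat} = insert 0 {1, 2, 3, 4, 5}" by auto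
    then show ?thesis
      by (simp add: val_def ts_def P' ev_list_add ev_map_uminus x_def algebra_simps nth_Cons')
  qed
  finally show "val P (Suc m) = val P' m - ev p (of_nat m) * state 0 m" by (simp add: x_def)
qed

section \<open>Telescoping along the certificate\<close>

lemma check_chain_nth:
  "check_chain Ps ps \<Longrightarrow> j < length ps \<Longrightarrow> check_step (Ps ! j) (Ps ! Suc j) (ps ! j)"
  by (induction Ps ps arbitrary: j rule: check_chain.induct) (auto simp: nth_Cons split: nat.splits)

lemma length_ode_coeffs: "length ode_coeffs = 25"
  by (simp add: ode_coeffs_def)

lemma cert_rows_0: "cert_rows ! 0 = hd ode_coeffs # replicate 5 []"
  by (simp add: cert_rows_def)

lemma cert_rows_24: "cert_rows ! 24 = replicate 6 []"
  by (simp add: cert_rows_def)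

lemma cert_rows_step: "j < 24 \<Longrightarrow> check_step (cert_rows ! j) (cert_rows ! Suc j) (ode_coeffs ! Suc j)"
  using check_chain_nth[OF check_cert_rows, of j] by (simp add: length_ode_coeffs nth_tl)

lemma length_cert_rows: "j \<le> 24 \<Longrightarrow> length (cert_rows ! j) = 6"
proof (induction j)
  case 0
  show ?case unfolding cert_rows_0 by simp
next
  case (Suc j)
  then show ?case using check_step_sound(1)[OF cert_rows_step[of j]] by simp
qed

text \<open>P_j(m) s(m) is the part i \<le> j of the coefficient of z^(m+j) in L R, up to the gauge.
  It is the whole coefficient when j = 24, and also when m = 0.\<close>

lemma val_cert_rows:
  "j \<le> 24 \<Longrightarrow> val (cert_rows ! j) m =
     (\<Sum>i\<le>j. ev (ode_coeffs ! i) (of_nat (m + j - i)) * state 0 (m + j - i))"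
proof (induction j arbitrary: m)
  case 0
  have "ode_coeffs \<noteq> []" using length_ode_coeffs by auto
  then show ?case
    unfolding val_def cert_rows_0 by (simp add: lessThan_6 hd_conv_nth)
next
  case (Suc j)
  have "val (cert_rows ! Suc j) m = val (cert_rows ! j) (Suc m) + ev (ode_coeffs ! Suc j) (of_nat m) * state 0 m"
    using check_step_sound(2)[OF cert_rows_step[of j], of m] Suc.prems length_cert_rows[of j] by simp
  \<comment> \<open>The induction hypothesis is taken at m + 1, which leaves the total index m + j +
    1 unchanged.\<close>
  then show ?case using Suc.IH[of "Suc m"] Suc.prems by simp
qed

section \<open>Initial values and the recurrence at every N\<close>

lemma Qpoly_1: "Qpoly (Suc 0) = px"
  by (rule poly_eqI) (auto simp: coeff_Qpoly px_def ct_pow_def coeff_pCons split: nat.splits)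

lemma val_cert_rows_0: "j \<le> 24 \<Longrightarrow> val (cert_rows ! j) 0 = 0"
proof -
  assume j: "j \<le> 24"
  have c: "coeff (pe 0) 0 = -2" "coeff (pf 0) 0 = 0" "coeff (pg 0) 0 = 2" "coeff (pf (Suc 0)) 0 = 2"
    by (simp_all add: pe_def pf_def pg_def coeff_Qpoly ct_pow_def)
  \<comment> \<open>Here g_1 = 2 Q_1 = 2 x, so the coefficient of x in f_1^4 g_1 is 2 f_1(0)^4 = 2 *
    2^4.\<close>
  have "seq_q (Suc 0) = 32"
    using c(4) by (simp add: seq_q_def pg_def Qpoly_1 mult.commute[of _ px] coeff_px_mult flip: poly_0_coeff_0)
  moreover have "seq_r 0 = 32" "seq_q 0 = 0" "seq_a 0 = 0" "seq_b 0 = -32" "seq_c 0 = 0"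
    using c by (simp_all add: seq_r_def seq_q_def seq_a_def seq_b_def seq_c_def flip: poly_0_coeff_0)
  ultimately have state0: "state 0 0 = 32" "state (Suc 0) 0 = 0" "state 2 0 = 1024" "state 3 0 = 0" "state 4 0 = -64" "state 5 0 = 0"
    by (simp_all add: state_def)
  have "length cert_rows = 25" by (simp add: cert_rows_def)
  with check_cert_rows_0 j have "32 * const_coeff (cert_rows ! j ! 0) + 1024 * const_coeff (cert_rows ! j ! 2)
      = 64 * const_coeff (cert_rows ! j ! 4)"
    by (simp add: list_all_length)
  then have "of_int (32 * const_coeff (cert_rows ! j ! 0) + 1024 * const_coeff (cert_rows ! j ! 2))
      = (of_int (64 * const_coeff (cert_rows ! j ! 4)) :: rat)"
    by (rule arg_cong)
  moreover have "ev xs 0 = of_int (const_coeff xs)" for xs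
    by (cases xs) (simp_all add: const_coeff_def)
  ultimately show ?thesis
    by (simp add: val_def lessThan_6 state0)
qed

text \<open>For N \<ge> 24 take j = 24 and m = N - 24, where the row is zero. For N < 24 take j = N
  and m = 0, where the initial vector annihilates the row; the sum then stops at i = N.\<close>

lemma state_recurrence:
  "(\<Sum>i\<le>min N 24. ev (ode_coeffs ! i) (of_nat (N - i)) * state 0 (N - i)) = 0"
proof (cases "N \<ge> 24")
  case True
  have "val (cert_rows ! 24) (N - 24) = 0"
    by (simp add: cert_rows_24 val_def lessThan_6)
  then show ?thesis using True by (simp add: val_cert_rows min_absorb2 del: of_nat_diff)
next
  case False
  then show ?thesis using val_cert_rows_0[of N] val_cert_rows[of N 0] by (simp add: min_def)
qed

section \<open>Return to r(n), the differential equation and the recurrence\<close>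

lemma state_eq_r45: "state 0 n = 32 * of_int (r45 n) / 8 ^ n"
  by (simp add: state_def seq_r_def pg_def r45_eq smult_power)

text \<open>Multiplying by 8^N / 32 removes the gauge: \<open>state 0 (N - i)\<close> carries
  8^(i-N), so 8^i remains and undoes the scaling of entry i of \<open>ode_coeffs\<close>.\<close>

lemma r45_recurrence:
  "(\<Sum>i\<le>min N 24. 8 ^ i * ev (ode_coeffs ! i) (of_nat (N - i)) * of_int (r45 (N - i))) = 0"
proof -
  have "(\<Sum>i\<le>min N 24. 8 ^ i * ev (ode_coeffs ! i) (of_nat (N - i)) * of_int (r45 (N - i)))
      = 8 ^ N / 32 * (\<Sum>i\<le>min N 24. ev (ode_coeffs ! i) (of_nat (N - i)) * state 0 (N - i))"
    unfolding sum_distrib_left by (intro sum.cong refl) (simp add: state_eq_r45 power_diff)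
  then show ?thesis by (simp only: state_recurrence mult_zero_right)
qed

lemma ev_ode_coeffs: "i < 25 \<Longrightarrow> ev (ode_coeffs ! i) t = (\<Sum>k\<le>9. of_int (ode_coeffs ! i ! k) * t ^ k)"
proof -
  assume i: "i < 25"
  have "list_all (\<lambda>xs. length xs = 10) ode_coeffs" by (simp add: ode_coeffs_def)
  then have "length (ode_coeffs ! i) = 10" using i by (simp add: list_all_length length_ode_coeffs)
  then show ?thesis
    by (simp add: horner_sum_eq_sum atLeast0LessThan flip: lessThan_Suc_atMost)
qed

lemma fps_nth_theta_power: "fps_nth ((theta ^^ k) R45) n = of_nat n ^ k * of_int (r45 n)"
proof (induction k arbitrary: n)
  case 0
  then show ?case by (simp add: R45_def)
next
  case (Suc k)
  then show ?case by (cases n) (simp_all add: theta_def)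
qed

lemma poly_Poly_of_int: "poly (Poly (map of_int xs)) t = ev xs t"
  by (induction xs) simp_all

theorem theorem4:
  shows "(\<exists>u :: nat \<Rightarrow> rat poly.
            (\<forall>k\<le>9. degree (u k) \<le> 24) \<and> u 9 \<noteq> 0 \<and>
            (\<exists>k\<le>9. degree (u k) = 24) \<and>
            (\<Sum>k\<le>9. fps_of_poly (u k) * (theta ^^ k) R45) = 0)
       \<and> (\<exists>h :: nat \<Rightarrow> rat poly.
            h 0 \<noteq> 0 \<and> h 24 \<noteq> 0 \<and>
            (\<forall>n::nat. (\<Sum>j\<le>24. poly (h j) (of_nat n) * of_int (r45 (n + j))) = 0))"
proof (intro conjI)
  \<comment> \<open>The operator is stored by powers of z; regrouping by powers of theta transposes
    the table, so \<open>u k\<close> collects the coefficients of theta^k.\<close>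
  define u :: "nat \<Rightarrow> rat poly" where
    "u k = Poly (map (\<lambda>i. 8 ^ i * of_int (ode_coeffs ! i ! k)) [0..<25])" for k
  have coeff_u: "coeff (u k) i = (if i < 25 then 8 ^ i * of_int (ode_coeffs ! i ! k) else 0)" for k i
    by (simp add: u_def nth_default_def)
  have deg: "degree (u k) \<le> 24" for k
    by (rule degree_le) (simp add: coeff_u)
  \<comment> \<open>The coefficient of z^24 still has degree 9 in theta, so k = 9 witnesses both the
    order and the exact degree.\<close>
  have "coeff (u 9) 24 \<noteq> 0"
    by (simp add: coeff_u ode_coeffs_def)
  then have "u 9 \<noteq> 0" "degree (u 9) = 24"
    using deg[of 9] le_degree[of "u 9" 24] by (auto intro: antisym)
  moreover have "(\<Sum>k\<le>9. fps_of_poly (u k) * (theta ^^ k) R45) = 0"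
  proof (rule fps_ext)
    fix N
    have "fps_nth (\<Sum>k\<le>9. fps_of_poly (u k) * (theta ^^ k) R45) N =
        (\<Sum>k\<le>9. \<Sum>i\<le>N. coeff (u k) i * (of_nat (N - i) ^ k * of_int (r45 (N - i))))"
      by (simp add: fps_sum_nth fps_mult_nth fps_nth_theta_power atLeast0AtMost)
    also have "\<dots> = (\<Sum>i\<le>N. \<Sum>k\<le>9. coeff (u k) i * (of_nat (N - i) ^ k * of_int (r45 (N - i))))"
      by (rule sum.swap)
    \<comment> \<open>theta^k multiplies the coefficient of z^n by n^k, so the inner sum over k
      evaluates the i-th polynomial at N - i.\<close>
    also have "\<dots> = (\<Sum>i\<le>N. if i < 25 then 8 ^ i * ev (ode_coeffs ! i) (of_nat (N - i)) * of_int (r45 (N - i)) else 0)"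
      by (intro sum.cong refl) (simp add: coeff_u ev_ode_coeffs sum_distrib_left sum_distrib_right mult.assoc)
    also have "\<dots> = (\<Sum>i\<in>{..N} \<inter> {i. i < 25}. 8 ^ i * ev (ode_coeffs ! i) (of_nat (N - i)) * of_int (r45 (N - i)))"
      by (simp add: sum.inter_restrict del: of_nat_diff)
    also have "{..N} \<inter> {i. i < 25} = {..min N 24}" by auto
    finally show "fps_nth (\<Sum>k\<le>9. fps_of_poly (u k) * (theta ^^ k) R45) N = fps_nth 0 N"
      by (simp only: r45_recurrence fps_zero_nth)
  qed
  ultimately show "\<exists>u :: nat \<Rightarrow> rat poly.
      (\<forall>k\<le>9. degree (u k) \<le> 24) \<and> u 9 \<noteq> 0 \<and> (\<exists>k\<le>9. degree (u k) = 24) \<and>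
      (\<Sum>k\<le>9. fps_of_poly (u k) * (theta ^^ k) R45) = 0"
    using deg by blast
next
  \<comment> \<open>With N = n + 24 and i = 24 - j the polynomial of index i is evaluated at n + j,
    hence the composition with a translation by j.\<close>
  define h :: "nat \<Rightarrow> rat poly" where
    "h j = smult (8 ^ (24 - j)) (pcompose (Poly (map of_int (ode_coeffs ! (24 - j)))) [:of_nat j, 1:])" for j
  have poly_h: "poly (h j) t = 8 ^ (24 - j) * ev (ode_coeffs ! (24 - j)) (t + of_nat j)" for j t
    by (simp add: h_def poly_pcompose poly_Poly_of_int add.commute)
  \<comment> \<open>At 0, \<open>h 0\<close> is a multiple of the constant coefficient of p_24,
    while \<open>h 24\<close> gives p_0(24). The zeros of p_0 are only 0, 1/2, 1, 3/2 and 2.\<close>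
  have "poly (h 0) 0 \<noteq> 0" "poly (h 24) 0 \<noteq> 0"
    by (simp_all add: poly_h ode_coeffs_def)
  then have "h 0 \<noteq> 0" "h 24 \<noteq> 0" by auto
  moreover have "(\<Sum>j\<le>24. poly (h j) (of_nat n) * of_int (r45 (n + j))) = 0" for n
  proof -
    have "(\<Sum>j\<le>24. poly (h j) (of_nat n) * of_int (r45 (n + j))) =
        (\<Sum>i\<le>24. 8 ^ i * ev (ode_coeffs ! i) (of_nat (n + 24 - i)) * of_int (r45 (n + 24 - i)))"
      by (rule sum.reindex_bij_witness[of _ "\<lambda>i. 24 - i" "\<lambda>j. 24 - j"]) (auto simp: poly_h)
    then show ?thesis using r45_recurrence[of "n + 24"] by simp
  qed
  ultimately show "\<exists>h :: nat \<Rightarrow> rat poly. h 0 \<noteq> 0 \<and> h 24 \<noteq> 0 \<and>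
      (\<forall>n::nat. (\<Sum>j\<le>24. poly (h j) (of_nat n) * of_int (r45 (n + j))) = 0)"
    by blast
qed

end
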